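(* Let $\Omega\subset\mathbb{R}^d$ be a convex polyhedral domain with faces $\Sigma_1,\dots,\Sigma_m$ and outer unit normals $\nu_1,\dots,\nu_m$, let $\mu,\gamma_1,\dots,\gamma_m\in\mathbb{R}$, and let $v$ be a solution of $$\Delta v+\mu=0\ \text{ in }\Omega,\qquad D_{\nu_i}v+\gamma_i=0\ \text{ on }\Sigma_i,\quad i=1,\dots,m.$$ If $v\in C^2(\overline\Omega)$, then $v$ is quadratic; that is, there are constants $a_{ij},b_i,c\in\mathbb{R}$ such that $$v(x)=\sum_{i,j=1}^d a_{ij}x_ix_j+\sum_{i=1}^d b_ix_i+c\qquad\text{for every }x\in\overline\Omega.$$
   Context: A convex polyhedral domain in $\mathbb{R}^d$ is a (non-empty) bounded open set $\Omega=\bigcap_{i=1}^m\{x\in\mathbb{R}^d: x\cdot\nu_i<b_i\}$ with unit vectors $\nu_i$ and constants $b_i$, the description being minimal (omitting any half-space gives a strictly larger set). Its faces are $\Sigma_i=\{x\in\overline\Omega: x\cdot\nu_i=b_i\}$, and $\nu_i$ is the outer unit normal on $\Sigma_i$. $v\in C^2(\overline\Omega)$ means that $v$ and its derivatives up to order two extend continuously to $\overline\Omega$. *)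

theory Defs
  imports "HOL-Analysis.Analysis"
begin

definition halfspaces_Int :: "(nat \<Rightarrow> real^'d) \<Rightarrow> (nat \<Rightarrow> real) \<Rightarrow> nat set \<Rightarrow> (real^'d) set" where
  "halfspaces_Int \<nu> b I = (\<Inter>i\<in>I. {x. x \<bullet> \<nu> i < b i})"

text \<open>The last conjunct is minimality of the description. Openness and convexity
  follow from \<open>\<Omega>\<close> being a finite intersection of open half-spaces.\<close>

definition convex_polyhedral_domain ::
    "(real^'d) set \<Rightarrow> nat \<Rightarrow> (nat \<Rightarrow> real^'d) \<Rightarrow> (nat \<Rightarrow> real) \<Rightarrow> bool" where
  "convex_polyhedral_domain \<Omega> m \<nu> b \<longleftrightarrow>
     \<Omega> \<noteq> {} \<and> bounded \<Omega> \<and>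
     (\<forall>i\<in>{1..m}. norm (\<nu> i) = 1) \<and>
     \<Omega> = halfspaces_Int \<nu> b {1..m} \<and>
     (\<forall>j\<in>{1..m}. \<Omega> \<subset> halfspaces_Int \<nu> b ({1..m} - {j}))"

definition face :: "(real^'d) set \<Rightarrow> (nat \<Rightarrow> real^'d) \<Rightarrow> (nat \<Rightarrow> real) \<Rightarrow> nat \<Rightarrow> (real^'d) set" where
  "face \<Omega> \<nu> b i = {x \<in> closure \<Omega>. x \<bullet> \<nu> i = b i}"

definition dir_deriv :: "real^'d \<Rightarrow> (real^'d \<Rightarrow> real) \<Rightarrow> real^'d \<Rightarrow> real" where
  "dir_deriv e f x = frechet_derivative f (at x) e"

abbreviation partial_deriv :: "'d \<Rightarrow> (real^'d \<Rightarrow> real) \<Rightarrow> real^'d \<Rightarrow> real" where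
  "partial_deriv i \<equiv> dir_deriv (axis i 1)"

definition laplacian :: "(real^'d \<Rightarrow> real) \<Rightarrow> real^'d \<Rightarrow> real" where
  "laplacian f x = (\<Sum>i\<in>UNIV. partial_deriv i (partial_deriv i f) x)"

definition extends_continuously :: "(real^'d) set \<Rightarrow> (real^'d \<Rightarrow> real) \<Rightarrow> bool" where
  "extends_continuously \<Omega> f \<longleftrightarrow>
     (\<exists>g. continuous_on (closure \<Omega>) g \<and> (\<forall>x\<in>\<Omega>. g x = f x))"

text \<open>The value at a point of the closure of the continuous extension of \<open>f\<close> from \<open>\<Omega>\<close>
  (see lemma \<open>cont_extension_eq\<close>).\<close>

definition cont_extension :: "(real^'d) set \<Rightarrow> (real^'d \<Rightarrow> real) \<Rightarrow> real^'d \<Rightarrow> real" where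
  "cont_extension \<Omega> f x = Lim (at x within \<Omega>) f"

lemma cont_extension_eq:
  fixes \<Omega> :: "(real^'d) set"
  assumes "open \<Omega>" "continuous_on (closure \<Omega>) g" "\<And>x. x \<in> \<Omega> \<Longrightarrow> g x = f x" "x \<in> closure \<Omega>"
  shows "cont_extension \<Omega> f x = g x"
proof -
  have "x islimpt \<Omega>"
  proof (cases "x \<in> \<Omega>")
    case True
    with assms(1) show ?thesis
      by (metis interior_limit_point interior_open)
  next
    case False
    with assms(4) show ?thesis
      by (simp add: closure_def)
  qed
  then have nt: "at x within \<Omega> \<noteq> bot"
    by (simp add: trivial_limit_within)
  have "(g \<longlongrightarrow> g x) (at x within closure \<Omega>)"
    using assms(2,4) by (simp add: continuous_on)
  then have "(g \<longlongrightarrow> g x) (at x within \<Omega>)"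
    by (rule tendsto_within_subset) (rule closure_subset)
  moreover have "eventually (\<lambda>y. g y = f y) (at x within \<Omega>)"
    using assms(3) by (auto simp: eventually_at_filter)
  ultimately have "(f \<longlongrightarrow> g x) (at x within \<Omega>)"
    by (rule Lim_transform_eventually)
  then show ?thesis
    unfolding cont_extension_def using nt by (rule tendsto_Lim[rotated])
qed

text \<open>\<open>v \<in> C\<^sup>2\<close> up to the boundary of an open set \<open>\<Omega>\<close>. The values of \<open>v\<close> on the boundary are
  those of its continuous extension; values off \<open>closure \<Omega>\<close> are irrelevant. As the partial
  derivatives are required to be continuous, Frechet differentiability is here equivalent to
  their mere existence; it is spelled out because \<open>frechet_derivative\<close> is a total function.\<close>

definition C2_closure :: "(real^'d) set \<Rightarrow> (real^'d \<Rightarrow> real) \<Rightarrow> bool" where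
  "C2_closure \<Omega> v \<longleftrightarrow>
     continuous_on (closure \<Omega>) v \<and>
     (\<forall>x\<in>\<Omega>. v differentiable (at x)) \<and>
     (\<forall>i. extends_continuously \<Omega> (partial_deriv i v)) \<and>
     (\<forall>i. \<forall>x\<in>\<Omega>. partial_deriv i v differentiable (at x)) \<and>
     (\<forall>i j. extends_continuously \<Omega> (partial_deriv j (partial_deriv i v)))"

text \<open>Classical solutions of the Neumann problem. On a face, the normal derivative is the
  continuous extension of the directional derivative inside \<open>\<Omega>\<close>, since \<open>v\<close> need not be
  given outside \<open>closure \<Omega>\<close>.\<close>

definition neumann_solution ::
    "(real^'d) set \<Rightarrow> nat \<Rightarrow> (nat \<Rightarrow> real^'d) \<Rightarrow> (nat \<Rightarrow> real) \<Rightarrow> real \<Rightarrow> (nat \<Rightarrow> real)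
      \<Rightarrow> (real^'d \<Rightarrow> real) \<Rightarrow> bool" where
  "neumann_solution \<Omega> m \<nu> b \<mu> \<gamma> v \<longleftrightarrow>
     (\<forall>x\<in>\<Omega>. laplacian v x + \<mu> = 0) \<and>
     (\<forall>i\<in>{1..m}. \<forall>x\<in>face \<Omega> \<nu> b i. cont_extension \<Omega> (dir_deriv (\<nu> i) v) x + \<gamma> i = 0)"

end

(* With u = |D^2 v|^2 (Frobenius norm), no C^2 function phi with negative Laplacian and positive
   outer normal derivative on the active faces can be such that u - phi has a local maximum on the
   closed polyhedron.
   At interior and face points, u is supported from below by a linear functional of D^2 v. On a face
   the normal is an eigenvector of D^2 v, so the equation turns this functional into one of purely
   tangential second derivatives; these are uniform limits of tangential second difference quotients
   of v, which are harmonic with zero normal derivative, so no regularity theory is needed.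
   At points where several faces meet, a logarithmic barrier, whose normal derivatives vanish on the
   faces, reduces to fewer active faces.
   Hopf's barrier -c exp(-alpha |x - y|^2) with y in the convex domain has positive normal derivative
   on every face, so u attains its maximum everywhere. Applying the interior part to D^2 v(x0) : D^2 v
   and using the equality case of Cauchy-Schwarz shows that D^2 v is locally constant. *)

theory Submission
  imports Defs
begin

text \<open>For smooth \<open>v\<close>, harmonicity of the third derivatives' potentials would make
  |D^2 v|^2 subharmonic, and one could differentiate it. Here D^2 v is only continuous up to the
  boundary, where its maximum may sit, so it has no normal derivative there; inequalities are tested
  on functions touching from above. Flatness of the faces is what makes this work. A small
  translation along a face preserves the domain near a point and the Neumann constant, so the
  constants \<gamma> cancel in second differences just as \<mu> does. Where faces with different
  normals meet, no single inward direction controls all of them. That set has codimension at least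
  two, too small for a bounded function to notice: minus the logarithm of the squared distance to it
  is superharmonic and infinite on it, and an arbitrarily small multiple outweighs the bounded |D^2
  v|^2 there.\<close>

section \<open>Functions with gradient and Laplacian, and barriers\<close>

text \<open>A relation instead of operators: gradient and Laplacian are exhibited by formulas, and
  barriers and difference quotients share one format. \<open>L\<close> is the trace of the
  derivative of the gradient; its continuity lets a strict sign at a point persist nearby.\<close>

definition has_grad_laplacian ::
    "('a::euclidean_space \<Rightarrow> real) \<Rightarrow> ('a \<Rightarrow> 'a) \<Rightarrow> ('a \<Rightarrow> real) \<Rightarrow> 'a set \<Rightarrow> bool" where
  "has_grad_laplacian f g L U \<longleftrightarrow> open U \<and> continuous_on U L \<and>
     (\<forall>x\<in>U. (f has_derivative (\<lambda>e. e \<bullet> g x)) (at x) \<and>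
        (\<exists>D. (g has_derivative D) (at x) \<and> L x = (\<Sum>i\<in>Basis. D i \<bullet> i)))"

lemma has_grad_laplacianD:
  assumes "has_grad_laplacian f g L U"
  shows "open U" "continuous_on U L" "continuous_on U f" "continuous_on U g"
    and "x \<in> U \<Longrightarrow> (f has_derivative (\<lambda>e. e \<bullet> g x)) (at x)"
proof -
  show "open U" "continuous_on U L"
    and "x \<in> U \<Longrightarrow> (f has_derivative (\<lambda>e. e \<bullet> g x)) (at x)"
    using assms by (auto simp: has_grad_laplacian_def)
  have "isCont f x" "isCont g x" if "x \<in> U" for x
    using assms that unfolding has_grad_laplacian_def by (meson has_derivative_continuous)+
  then show "continuous_on U f" "continuous_on U g"
    by (simp_all add: continuous_at_imp_continuous_on)
qed

lemma has_grad_laplacianE: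
  assumes "has_grad_laplacian f g L U" "x \<in> U"
  obtains D where "(g has_derivative D) (at x)" "L x = (\<Sum>i\<in>Basis. D i \<bullet> i)"
  using assms unfolding has_grad_laplacian_def by blast

lemma has_grad_laplacian_subset:
  assumes "has_grad_laplacian f g L U" "V \<subseteq> U" "open V"
  shows "has_grad_laplacian f g L V"
  using assms continuous_on_subset[of U L V] by (auto simp: has_grad_laplacian_def subset_iff)

lemma has_grad_laplacian_add:
  assumes "has_grad_laplacian f1 g1 L1 U" "has_grad_laplacian f2 g2 L2 U"
  shows "has_grad_laplacian (\<lambda>x. f1 x + f2 x) (\<lambda>x. g1 x + g2 x) (\<lambda>x. L1 x + L2 x) U"
  unfolding has_grad_laplacian_def
proof (intro conjI ballI)
  show "open U" "continuous_on U (\<lambda>x. L1 x + L2 x)"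
    using assms by (auto simp: has_grad_laplacian_def intro: continuous_intros)
  fix x assume x: "x \<in> U"
  show "((\<lambda>x. f1 x + f2 x) has_derivative (\<lambda>e. e \<bullet> (g1 x + g2 x))) (at x)"
    using assms x by (auto simp: inner_add_right intro: has_derivative_add has_grad_laplacianD(5))
  obtain D1 where "(g1 has_derivative D1) (at x)" "L1 x = (\<Sum>i\<in>Basis. D1 i \<bullet> i)"
    using assms(1) x by (rule has_grad_laplacianE)
  moreover obtain D2 where "(g2 has_derivative D2) (at x)" "L2 x = (\<Sum>i\<in>Basis. D2 i \<bullet> i)"
    using assms(2) x by (rule has_grad_laplacianE)
  ultimately show "\<exists>D. ((\<lambda>x. g1 x + g2 x) has_derivative D) (at x) \<and>
      L1 x + L2 x = (\<Sum>i\<in>Basis. D i \<bullet> i)"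
    by (intro exI[of _ "\<lambda>e. D1 e + D2 e"])
       (auto simp: sum.distrib inner_add_left intro: has_derivative_add)
qed

lemma has_grad_laplacian_cmul:
  assumes "has_grad_laplacian f g L U"
  shows "has_grad_laplacian (\<lambda>x. c * f x) (\<lambda>x. c *\<^sub>R g x) (\<lambda>x. c * L x) U"
  unfolding has_grad_laplacian_def
proof (intro conjI ballI)
  show "open U" "continuous_on U (\<lambda>x. c * L x)"
    using assms by (auto simp: has_grad_laplacian_def intro: continuous_intros)
  fix x assume x: "x \<in> U"
  show "((\<lambda>x. c * f x) has_derivative (\<lambda>e. e \<bullet> (c *\<^sub>R g x))) (at x)"
    using has_derivative_mult_right[OF has_grad_laplacianD(5)[OF assms x]] by simp
  obtain D where "(g has_derivative D) (at x)" "L x = (\<Sum>i\<in>Basis. D i \<bullet> i)"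
    using assms x by (rule has_grad_laplacianE)
  then show "\<exists>D. ((\<lambda>x. c *\<^sub>R g x) has_derivative D) (at x) \<and>
      c * L x = (\<Sum>i\<in>Basis. D i \<bullet> i)"
    by (intro exI[of _ "\<lambda>e. c *\<^sub>R D e"])
       (auto simp: sum_distrib_left intro: has_derivative_scaleR_right)
qed

lemma has_grad_laplacian_diff:
  assumes "has_grad_laplacian f1 g1 L1 U" "has_grad_laplacian f2 g2 L2 U"
  shows "has_grad_laplacian (\<lambda>x. f1 x - f2 x) (\<lambda>x. g1 x - g2 x) (\<lambda>x. L1 x - L2 x) U"
  using has_grad_laplacian_add[OF assms(1) has_grad_laplacian_cmul[OF assms(2), of "-1"]] by simp

lemma has_grad_laplacian_zero:
  assumes "open U"
  shows "has_grad_laplacian (\<lambda>x. 0) (\<lambda>x. 0) (\<lambda>x. 0) U"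
  unfolding has_grad_laplacian_def
  by (intro conjI ballI exI[of _ "\<lambda>x. 0"]) (simp_all add: assms)

lemma has_grad_laplacian_sum:
  assumes "finite F" "open U" "\<And>i. i \<in> F \<Longrightarrow> has_grad_laplacian (f i) (g i) (L i) U"
  shows "has_grad_laplacian (\<lambda>x. \<Sum>i\<in>F. f i x) (\<lambda>x. \<Sum>i\<in>F. g i x) (\<lambda>x. \<Sum>i\<in>F. L i x) U"
  using assms by (induction F) (auto intro: has_grad_laplacian_zero has_grad_laplacian_add)

lemma has_grad_laplacian_translate:
  assumes "has_grad_laplacian f g L U" "open V" "\<And>x. x \<in> V \<Longrightarrow> x + a \<in> U"
  shows "has_grad_laplacian (\<lambda>x. f (x + a)) (\<lambda>x. g (x + a)) (\<lambda>x. L (x + a)) V"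
  unfolding has_grad_laplacian_def
proof (intro conjI ballI)
  show "open V" by fact
  show "continuous_on V (\<lambda>x. L (x + a))"
    by (rule continuous_on_compose2[OF has_grad_laplacianD(2)[OF assms(1)]])
       (use assms(3) in \<open>auto intro!: continuous_intros\<close>)
  fix x assume x: "x \<in> V"
  have *: "((\<lambda>x. x + a) has_derivative (\<lambda>e. e)) (at x)"
    by (auto intro!: derivative_eq_intros)
  show "((\<lambda>x. f (x + a)) has_derivative (\<lambda>e. e \<bullet> g (x + a))) (at x)"
    using has_derivative_compose[OF * has_grad_laplacianD(5)[OF assms(1) assms(3)[OF x]]] .
  obtain D where "(g has_derivative D) (at (x + a))" "L (x + a) = (\<Sum>i\<in>Basis. D i \<bullet> i)"
    using assms(1) assms(3)[OF x] by (rule has_grad_laplacianE)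
  with has_derivative_compose[OF *, of g D]
  show "\<exists>D. ((\<lambda>x. g (x + a)) has_derivative D) (at x) \<and> L (x + a) = (\<Sum>i\<in>Basis. D i \<bullet> i)"
    by auto
qed

lemma has_grad_laplacian_compose:
  assumes f: "has_grad_laplacian f g L U"
    and "\<And>x. x \<in> U \<Longrightarrow> (\<psi> has_real_derivative \<psi>' (f x)) (at (f x))"
    and "\<And>x. x \<in> U \<Longrightarrow> (\<psi>' has_real_derivative \<psi>'' (f x)) (at (f x))"
    and "continuous_on U (\<lambda>x. \<psi>'' (f x))"
  shows "has_grad_laplacian (\<lambda>x. \<psi> (f x)) (\<lambda>x. \<psi>' (f x) *\<^sub>R g x)
           (\<lambda>x. \<psi>' (f x) * L x + \<psi>'' (f x) * (norm (g x))\<^sup>2) U"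
  unfolding has_grad_laplacian_def
proof (intro conjI ballI)
  show "open U" using f by (rule has_grad_laplacianD)
  have \<psi>': "((\<lambda>x. \<psi>' (f x)) has_derivative (\<lambda>e. (e \<bullet> g x) * \<psi>'' (f x))) (at x)" if "x \<in> U" for x
    using has_derivative_compose[OF has_grad_laplacianD(5)[OF f that]
        assms(3)[OF that, THEN has_field_derivative_imp_has_derivative]]
    by (simp add: mult.commute)
  have "continuous_on U (\<lambda>x. \<psi>' (f x))"
    using \<psi>' has_derivative_continuous by (intro continuous_at_imp_continuous_on) blast
  then show "continuous_on U (\<lambda>x. \<psi>' (f x) * L x + \<psi>'' (f x) * (norm (g x))\<^sup>2)"
    using has_grad_laplacianD[OF f] assms(4) by (auto intro!: continuous_intros)
  fix x assume x: "x \<in> U"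
  show "((\<lambda>x. \<psi> (f x)) has_derivative (\<lambda>e. e \<bullet> (\<psi>' (f x) *\<^sub>R g x))) (at x)"
    using has_derivative_compose[OF has_grad_laplacianD(5)[OF f x]
        assms(2)[OF x, THEN has_field_derivative_imp_has_derivative]] by simp
  obtain D where D: "(g has_derivative D) (at x)" "L x = (\<Sum>i\<in>Basis. D i \<bullet> i)"
    using f x by (rule has_grad_laplacianE)
  have "(\<Sum>i\<in>Basis. (\<psi>' (f x) *\<^sub>R D i + ((i \<bullet> g x) * \<psi>'' (f x)) *\<^sub>R g x) \<bullet> i)
     = \<psi>' (f x) * L x + \<psi>'' (f x) * (\<Sum>i\<in>Basis. (g x \<bullet> i) * (g x \<bullet> i))"
    by (simp add: D(2) inner_add_left sum.distrib sum_distrib_left inner_commute[of _ "g x"] mult_ac)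
  also have "(\<Sum>i\<in>Basis. (g x \<bullet> i) * (g x \<bullet> i)) = (norm (g x))\<^sup>2"
    by (simp add: euclidean_inner[symmetric] power2_norm_eq_inner)
  finally show "\<exists>D. ((\<lambda>x. \<psi>' (f x) *\<^sub>R g x) has_derivative D) (at x) \<and>
      \<psi>' (f x) * L x + \<psi>'' (f x) * (norm (g x))\<^sup>2 = (\<Sum>i\<in>Basis. D i \<bullet> i)"
    using has_derivative_scaleR[OF \<psi>'[OF x] D(1)] by metis
qed

text \<open>The trace of \<open>e \<mapsto> 2 (e \<bullet> b) b\<close> is
  \<open>2 (b \<bullet> b)\<close>. For orthonormal \<open>B\<close> the function is the squared
  distance to the affine subspace through \<open>a\<close> orthogonal to \<open>B\<close>, the
  argument of the logarithmic barrier.\<close>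

lemma has_grad_laplacian_quadratic:
  fixes B :: "'a::euclidean_space set"
  assumes "finite B" "\<And>b. b \<in> B \<Longrightarrow> norm b = 1"
  shows "has_grad_laplacian (\<lambda>x. \<Sum>b\<in>B. ((x - a) \<bullet> b)\<^sup>2) (\<lambda>x. \<Sum>b\<in>B. (2 * ((x - a) \<bullet> b)) *\<^sub>R b)
           (\<lambda>x. 2 * real (card B)) UNIV"
  unfolding has_grad_laplacian_def
proof (intro conjI ballI)
  fix x :: 'a
  show "((\<lambda>x. \<Sum>b\<in>B. ((x - a) \<bullet> b)\<^sup>2) has_derivative
      (\<lambda>e. e \<bullet> (\<Sum>b\<in>B. (2 * ((x - a) \<bullet> b)) *\<^sub>R b))) (at x)"
    by (auto intro!: derivative_eq_intros sum.cong simp: inner_sum_right)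
  have "(\<Sum>i\<in>Basis. (\<Sum>b\<in>B. (2 * (i \<bullet> b)) *\<^sub>R b) \<bullet> i) = (\<Sum>i\<in>Basis. \<Sum>b\<in>B. 2 * ((b \<bullet> i) * (b \<bullet> i)))"
    unfolding inner_sum_left by (intro sum.cong refl) (simp add: inner_commute)
  also have "\<dots> = (\<Sum>b\<in>B. 2 * (b \<bullet> b))"
    unfolding euclidean_inner[of b b for b] sum_distrib_left by (rule sum.swap)
  also have "\<dots> = 2 * real (card B)"
    using assms(2) by (simp add: norm_eq_1)
  finally have "2 * real (card B) = (\<Sum>i\<in>Basis. (\<Sum>b\<in>B. (2 * (i \<bullet> b)) *\<^sub>R b) \<bullet> i)" ..
  moreover have "((\<lambda>x. \<Sum>b\<in>B. (2 * ((x - a) \<bullet> b)) *\<^sub>R b) has_derivative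
        (\<lambda>e. \<Sum>b\<in>B. (2 * (e \<bullet> b)) *\<^sub>R b)) (at x)"
    by (auto intro!: derivative_eq_intros sum.cong)
  ultimately show "\<exists>D. ((\<lambda>x. \<Sum>b\<in>B. (2 * ((x - a) \<bullet> b)) *\<^sub>R b) has_derivative D) (at x) \<and>
      2 * real (card B) = (\<Sum>i\<in>Basis. D i \<bullet> i)"
    by blast
qed auto

lemma has_grad_laplacian_norm_square:
  fixes a :: "'a::euclidean_space"
  shows "has_grad_laplacian (\<lambda>x. (norm (x - a))\<^sup>2) (\<lambda>x. 2 *\<^sub>R (x - a)) (\<lambda>x. 2 * DIM('a)) UNIV"
proof -
  have "(\<Sum>b\<in>Basis. ((x - a) \<bullet> b)\<^sup>2) = (norm (x - a))\<^sup>2" for x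
    unfolding power2_norm_eq_inner euclidean_inner[of "x - a" "x - a"] by (simp add: power2_eq_square)
  moreover have "(\<Sum>b\<in>Basis. (2 * ((x - a) \<bullet> b)) *\<^sub>R b) = 2 *\<^sub>R (x - a)" for x
  proof -
    have "(\<Sum>b\<in>Basis. (2 * ((x - a) \<bullet> b)) *\<^sub>R b) = 2 *\<^sub>R (\<Sum>b\<in>Basis. ((x - a) \<bullet> b) *\<^sub>R b)"
      unfolding scaleR_sum_right by simp
    then show ?thesis by (simp only: euclidean_representation)
  qed
  ultimately show ?thesis
    using has_grad_laplacian_quadratic[of Basis a] by simp
qed

section \<open>Interior maxima and Hopf's barrier\<close>

lemma laplacian_nonpos_at_local_max:
  fixes f :: "'a::euclidean_space \<Rightarrow> real"
  assumes f: "has_grad_laplacian f g L U" and x: "x \<in> U"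
    and "d > 0" and max: "\<And>y. dist y x < d \<Longrightarrow> f y \<le> f x"
  shows "L x \<le> 0"
proof (rule ccontr)
  assume "\<not> L x \<le> 0"
  obtain D where D: "(g has_derivative D) (at x)" "L x = (\<Sum>i\<in>Basis. D i \<bullet> i)"
    using f x by (rule has_grad_laplacianE)
  \<comment> \<open>A positive trace has a positive diagonal entry. As the gradient vanishes at the
    maximum, the derivative along this basis vector becomes positive just beyond \<open>x\<close>,
    so \<open>f\<close> increases there.\<close>
  have "\<exists>i\<in>Basis. D i \<bullet> i > 0"
  proof (rule ccontr)
    assume "\<not> ?thesis"
    then have "L x \<le> 0" unfolding D(2) by (intro sum_nonpos) (auto simp: not_less)
    with \<open>\<not> L x \<le> 0\<close> show False by simp
  qed
  then obtain i where i: "i \<in> Basis" "D i \<bullet> i > 0" by blast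
  have "\<forall>y\<in>ball x d. f y \<le> f x"
    using max by (auto simp: dist_commute)
  then have "(\<lambda>e. e \<bullet> g x) = (\<lambda>v. 0)"
    using differential_zero_maxmin[of x "ball x d" f] has_grad_laplacianD(5)[OF f x] \<open>d > 0\<close> by simp
  then have gx: "g x = 0" by (metis (no_types) inner_eq_zero_iff)
  obtain r where r: "r > 0" "ball x r \<subseteq> U"
    using has_grad_laplacianD(1)[OF f] x openE by blast
  have line: "((\<lambda>s. x + s *\<^sub>R i) has_derivative (\<lambda>s. s *\<^sub>R i)) (at s)" for s :: real
    by (auto intro!: derivative_eq_intros)
  have "((\<lambda>s. g (x + s *\<^sub>R i)) has_derivative (\<lambda>s. D (s *\<^sub>R i))) (at 0)"
    using has_derivative_compose[OF line[of 0], of g D] D(1) by simp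
  then have "((\<lambda>s. g (x + s *\<^sub>R i) \<bullet> i) has_derivative (\<lambda>s. D (s *\<^sub>R i) \<bullet> i)) (at 0)"
    by (rule has_derivative_inner_left)
  moreover have "(\<lambda>s. D (s *\<^sub>R i) \<bullet> i) = (*) (D i \<bullet> i)"
    using has_derivative_linear[OF D(1)] by (auto simp: linear_scale)
  ultimately have "((\<lambda>s. g (x + s *\<^sub>R i) \<bullet> i) has_real_derivative D i \<bullet> i) (at 0)"
    by (simp add: has_field_derivative_def)
  from DERIV_pos_inc_right[OF this i(2)]
  obtain e where e: "e > 0" "\<And>s. 0 < s \<Longrightarrow> s < e \<Longrightarrow> g (x + s *\<^sub>R i) \<bullet> i > 0"
    using gx by auto
  define s where "s = min (min (e/2) (d/2)) (r/2)"
  have s: "0 < s" "s < e" "s < d" "s < r"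
    using e(1) \<open>d > 0\<close> r(1) unfolding s_def by linarith+
  have in_U: "x + t *\<^sub>R i \<in> U" if "0 \<le> t" "t \<le> s" for t
  proof -
    have "x + t *\<^sub>R i \<in> ball x r" using that s i(1) by (simp add: dist_norm)
    then show ?thesis using r(2) by blast
  qed
  have der: "((\<lambda>s. f (x + s *\<^sub>R i)) has_real_derivative g (x + t *\<^sub>R i) \<bullet> i) (at t)"
    if "0 \<le> t" "t \<le> s" for t
    using has_derivative_compose[OF line has_grad_laplacianD(5)[OF f in_U[OF that]]]
    by (auto simp: has_field_derivative_def inner_commute mult.commute[of "_ \<bullet> _"] elim!: has_derivative_eq_rhs)
  have "f (x + 0 *\<^sub>R i) < f (x + s *\<^sub>R i)"
  proof (rule DERIV_pos_imp_increasing_open[OF s(1)])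
    show "\<exists>y. ((\<lambda>s. f (x + s *\<^sub>R i)) has_real_derivative y) (at t) \<and> y > 0" if "0 < t" "t < s" for t
      using der[of t] e(2)[of t] that s by force
    show "continuous_on {0..s} (\<lambda>s. f (x + s *\<^sub>R i))"
      using der by (intro continuous_at_imp_continuous_on) (auto intro!: DERIV_isCont der)
  qed
  moreover have "f (x + s *\<^sub>R i) \<le> f x"
    using s i(1) by (intro max) (simp add: dist_norm)
  ultimately show False by simp
qed

text \<open>Let \<open>p\<close> be a point with value \<open>N\<close> nearest to \<open>y\<close>,
  at distance \<open>R\<close>. Adding c exp(-\<alpha> |x - y|^2) to \<open>u\<close> lifts the
  value at \<open>p\<close> above \<open>N\<close>. This level is not reached on the sphere of
  radius R/2, where \<open>u\<close> stays away from \<open>N\<close>, nor beyond radius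
  \<open>R\<close>, where the exponential is smaller. So the maximum outside the inner ball lies in
  the shell between. The bound on \<open>dist x y\<close> serves to keep the contact point inside a
  given ball.\<close>

lemma hopf_barrier:
  fixes y :: "'a::euclidean_space"
  assumes "compact K" "continuous_on K u" "\<And>x. x \<in> K \<Longrightarrow> u x \<le> N"
    and "z \<in> K" "u z = N" "y \<in> K" "u y < N"
  obtains x \<phi> g L c d where "x \<in> K" "dist x y \<le> dist z y" "has_grad_laplacian \<phi> g L UNIV"
    "L x < 0" "c > 0" "g x = c *\<^sub>R (x - y)" "d > 0"
    "\<And>w. w \<in> K \<Longrightarrow> dist w x < d \<Longrightarrow> u w - \<phi> w \<le> u x - \<phi> x"
proof -
  define A where "A = {x \<in> K. u x = N}"
  have "closed A" unfolding A_def
    using continuous_closed_preimage_constant[OF assms(2) compact_imp_closed[OF assms(1)], of N] by simp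
  have "z \<in> A" using assms by (simp add: A_def)
  obtain p where p: "p \<in> A" "\<And>x. x \<in> A \<Longrightarrow> dist y p \<le> dist y x"
    using distance_attains_inf[OF \<open>closed A\<close>, of y] \<open>z \<in> A\<close> by blast
  define R where "R = dist y p"
  have "R > 0" using p(1) assms(7) by (auto simp: R_def A_def)
  \<comment> \<open>The Laplacian of \<open>E\<close> is positive where 4 \<alpha> |x - y|^2 exceeds
    twice the dimension. Outside radius R/2 the left side is larger than \<alpha> R^2, which is
    three times the dimension.\<close>
  define \<alpha> where "\<alpha> = 3 * DIM('a) / R\<^sup>2"
  have \<alpha>: "\<alpha> > 0" using \<open>R > 0\<close> by (simp add: \<alpha>_def)
  define E where "E x = exp (- \<alpha> * (norm (x - y))\<^sup>2)" for x
  define C where "C = {x \<in> K. dist y x \<ge> R/2}"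
  define S where "S = {x \<in> K. dist y x = R/2}"
  have "C = K \<inter> - ball y (R/2)" "S = K \<inter> sphere y (R/2)"
    by (auto simp: C_def S_def)
  then have cpt: "compact C" "compact S"
    using assms(1) by (auto simp: compact_Int_closed)
  obtain \<delta> where \<delta>: "\<delta> > 0" "\<And>x. x \<in> S \<Longrightarrow> u x \<le> N - \<delta>"
  proof (cases "S = {}")
    case True
    then show ?thesis using that[of 1] by auto
  next
    case False
    obtain s where s: "s \<in> S" "\<And>x. x \<in> S \<Longrightarrow> u x \<le> u s"
      using continuous_attains_sup[OF cpt(2) False, of u] assms(2) continuous_on_subset
      by (metis (no_types, lifting) S_def mem_Collect_eq subsetI)
    have "u s \<noteq> N"
      using s(1) p(2)[of s] \<open>R > 0\<close> unfolding S_def A_def R_def by auto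
    then have "u s < N" using s(1) assms(3)[of s] by (auto simp: S_def)
    then show ?thesis using that[of "N - u s"] s(2) by fastforce
  qed
  \<comment> \<open>As \<open>E \<le> 1\<close>, any positive \<open>c\<close> below \<delta> keeps
    \<open>u - \<phi>\<close> under \<open>N\<close> on \<open>S\<close>.\<close>
  define c where "c = \<delta> / 2"
  have c: "c > 0" "c < \<delta>" using \<delta>(1) by (auto simp: c_def)
  define \<phi> where "\<phi> x = - c * E x" for x
  have hq: "has_grad_laplacian E (\<lambda>x. (- \<alpha> * E x) *\<^sub>R (2 *\<^sub>R (x - y)))
      (\<lambda>x. - \<alpha> * E x * (2 * DIM('a)) + (\<alpha>\<^sup>2 * E x) * (norm (2 *\<^sub>R (x - y)))\<^sup>2) UNIV"
    unfolding E_def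
    by (rule has_grad_laplacian_compose[OF has_grad_laplacian_norm_square,
          where \<psi> = "\<lambda>t. exp (- \<alpha> * t)" and \<psi>' = "\<lambda>t. - \<alpha> * exp (- \<alpha> * t)"
            and \<psi>'' = "\<lambda>t. \<alpha>\<^sup>2 * exp (- \<alpha> * t)"])
       (auto intro!: derivative_eq_intros continuous_intros simp: power2_eq_square)
  have h\<phi>: "has_grad_laplacian \<phi> (\<lambda>x. - c *\<^sub>R ((- \<alpha> * E x) *\<^sub>R (2 *\<^sub>R (x - y))))
      (\<lambda>x. - c * (- \<alpha> * E x * (2 * DIM('a)) + (\<alpha>\<^sup>2 * E x) * (norm (2 *\<^sub>R (x - y)))\<^sup>2)) UNIV"
    unfolding \<phi>_def by (rule has_grad_laplacian_cmul[OF hq])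
  have "p \<in> C" using p(1) \<open>R > 0\<close> by (auto simp: C_def A_def R_def)
  have cont\<phi>: "continuous_on UNIV \<phi>" by (rule has_grad_laplacianD[OF h\<phi>])
  have "continuous_on C (\<lambda>w. u w - \<phi> w)"
    by (intro continuous_on_diff continuous_on_subset[OF assms(2)] continuous_on_subset[OF cont\<phi>])
       (auto simp: C_def)
  moreover have "C \<noteq> {}" using \<open>p \<in> C\<close> by blast
  ultimately obtain x where x: "x \<in> C" "\<And>w. w \<in> C \<Longrightarrow> u w - \<phi> w \<le> u x - \<phi> x"
    using continuous_attains_sup[OF cpt(1), of "\<lambda>w. u w - \<phi> w"] by blast
  have Ep: "E p = exp (- \<alpha> * R\<^sup>2)" by (simp add: E_def R_def dist_norm norm_minus_commute)
  have ge: "u x - \<phi> x \<ge> N + c * exp (- \<alpha> * R\<^sup>2)"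
    using x(2)[OF \<open>p \<in> C\<close>] p(1) by (simp add: \<phi>_def Ep A_def)
  have xK: "x \<in> K" using x(1) by (simp add: C_def)
  have "x \<notin> S"
  proof
    assume "x \<in> S"
    then have "u x \<le> N - \<delta>" by (rule \<delta>)
    moreover have "c * E x \<le> c * 1"
      using c \<alpha> by (intro mult_left_mono) (auto simp: E_def)
    moreover have "c * exp (- \<alpha> * R\<^sup>2) > 0" using c by simp
    ultimately show False using ge c unfolding \<phi>_def by linarith
  qed
  then have far: "dist y x > R/2" using x(1) by (auto simp: C_def S_def)
  have near: "dist x y \<le> R"
  proof (rule ccontr)
    assume "\<not> dist x y \<le> R"
    then have "R\<^sup>2 < (norm (x - y))\<^sup>2"
      using \<open>R > 0\<close> by (intro power_strict_mono) (auto simp: dist_norm)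
    then have "E x < exp (- \<alpha> * R\<^sup>2)" using \<alpha> by (simp add: E_def)
    then have "c * E x < c * exp (- \<alpha> * R\<^sup>2)" using c by simp
    then show False using ge assms(3)[OF xK] by (simp add: \<phi>_def)
  qed
  have E0: "E x > 0" by (simp add: E_def)
  have "(R/2)\<^sup>2 < (norm (x - y))\<^sup>2"
    using \<open>R > 0\<close> far by (intro power_strict_mono) (auto simp: dist_norm norm_minus_commute)
  then have "\<alpha> * R\<^sup>2 < \<alpha> * (4 * (norm (x - y))\<^sup>2)"
    using \<alpha> by (simp add: power2_eq_square)
  then have "3 * DIM('a) < \<alpha> * (4 * (norm (x - y))\<^sup>2)"
    using \<open>R > 0\<close> by (simp add: \<alpha>_def)
  then have "2 * DIM('a) < \<alpha> * (4 * (norm (x - y))\<^sup>2)"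
    using DIM_positive[where 'a='a] by linarith
  then have "(c * \<alpha> * E x) * (2 * DIM('a)) < (c * \<alpha> * E x) * (\<alpha> * (4 * (norm (x - y))\<^sup>2))"
    using c \<alpha> E0 by (intro mult_strict_left_mono) auto
  then have Lneg: "- c * (- \<alpha> * E x * (2 * DIM('a)) + (\<alpha>\<^sup>2 * E x) * (norm (2 *\<^sub>R (x - y)))\<^sup>2) < 0"
    unfolding norm_scaleR by (simp add: algebra_simps power2_eq_square)
  have "dist x y \<le> dist z y" using near p(2)[OF \<open>z \<in> A\<close>] by (simp add: R_def dist_commute)
  \<comment> \<open>\<open>x\<close> is strictly farther than R/2 from \<open>y\<close>, so near
    \<open>x\<close> the sets \<open>C\<close> and \<open>K\<close> coincide and the maximum over
    \<open>C\<close> is local in \<open>K\<close>.\<close>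
  moreover have "w \<in> C" if "w \<in> K" "dist w x < dist y x - R/2" for w
    using that dist_triangle[of y x w] by (simp add: C_def dist_commute)
  ultimately show ?thesis
    using c \<alpha> E0 x(2) far
    by (intro that[OF xK _ h\<phi> Lneg, of "2 * c * \<alpha> * E x" "dist y x - R/2"]) auto
qed

section \<open>Logarithmic barriers\<close>

lemma orthonormal_coeff:
  fixes B :: "'b::real_inner set"
  assumes "finite B" "pairwise orthogonal B" "\<And>x. x \<in> B \<Longrightarrow> norm x = 1" "x \<in> B"
  shows "(\<Sum>y\<in>B. f y *\<^sub>R y) \<bullet> x = f x"
proof -
  have "f y * (y \<bullet> x) = (if y = x then f x else 0)" if "y \<in> B" for y
    using assms that by (auto simp: norm_eq_1 pairwise_def orthogonal_def)
  then show ?thesis using assms(1,4) by (simp add: inner_sum_left sum.delta' cong: sum.cong)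
qed

lemma orthonormal_inner_span:
  fixes B :: "'b::real_inner set"
  assumes "finite B" "pairwise orthogonal B" "\<And>x. x \<in> B \<Longrightarrow> norm x = 1" "x \<in> span B"
  shows "(\<Sum>e\<in>B. (y \<bullet> e) *\<^sub>R e) \<bullet> x = y \<bullet> x"
proof -
  have "orthogonal (y - (\<Sum>e\<in>B. (y \<bullet> e) *\<^sub>R e)) x"
    by (rule orthogonal_to_span[OF assms(4)])
       (simp add: orthogonal_def inner_diff_left orthonormal_coeff[OF assms(1-3)])
  then show ?thesis by (simp add: orthogonal_def inner_diff_left)
qed

text \<open>\<open>q\<close> is the squared distance to the affine subspace through \<open>a\<close>
  orthogonal to \<open>B\<close>, and |grad q|^2 = 4 q. With k = \<open>card B\<close> the Laplacian
  of -ln q is (4 - 2 k) / q, so codimension at least two gives the sign. The gradient is a multiple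
  of the projection of \<open>x - a\<close> to \<open>span B\<close>, hence has no component along a
  normal in \<open>span B\<close> that is orthogonal to \<open>x - a\<close>.\<close>

lemma log_barrier:
  fixes B :: "'a::euclidean_space set" and a :: 'a
  assumes B: "finite B" "pairwise orthogonal B" "\<And>x. x \<in> B \<Longrightarrow> norm x = 1" and "card B \<ge> 2"
  defines "q \<equiv> \<lambda>x. \<Sum>e\<in>B. ((x - a) \<bullet> e)\<^sup>2"
  obtains g L where "has_grad_laplacian (\<lambda>x. - ln (q x)) g L {x. q x > 0}"
    "\<And>x. q x > 0 \<Longrightarrow> L x \<le> 0"
    "\<And>x n. n \<in> span B \<Longrightarrow> (x - a) \<bullet> n = 0 \<Longrightarrow> g x \<bullet> n = 0"
proof -
  define dq where "dq x = (\<Sum>e\<in>B. (2 * ((x - a) \<bullet> e)) *\<^sub>R e)" for x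
  have q: "has_grad_laplacian q dq (\<lambda>x. 2 * real (card B)) UNIV"
    unfolding q_def dq_def using B by (intro has_grad_laplacian_quadratic)
  have "open {x. q x > 0}"
    using has_grad_laplacianD(3)[OF q] by (intro open_Collect_less continuous_on_const) auto
  then have q': "has_grad_laplacian q dq (\<lambda>x. 2 * real (card B)) {x. q x > 0}"
    by (intro has_grad_laplacian_subset[OF q]) auto
  have "has_grad_laplacian (\<lambda>x. - ln (q x)) (\<lambda>x. (- inverse (q x)) *\<^sub>R dq x)
     (\<lambda>x. - inverse (q x) * (2 * real (card B)) + inverse ((q x)\<^sup>2) * (norm (dq x))\<^sup>2) {x. q x > 0}"
  proof (rule has_grad_laplacian_compose[OF q', where \<psi> = "\<lambda>t. - ln t" and \<psi>' = "\<lambda>t. - inverse t"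
        and \<psi>'' = "\<lambda>t. inverse (t\<^sup>2)"])
    show "continuous_on {x. q x > 0} (\<lambda>x. inverse ((q x)\<^sup>2))"
      by (intro continuous_intros has_grad_laplacianD(3)[OF q']) auto
  qed (auto intro!: derivative_eq_intros simp: power2_eq_square field_simps)
  moreover have "- inverse (q x) * (2 * real (card B)) + inverse ((q x)\<^sup>2) * (norm (dq x))\<^sup>2 \<le> 0"
    if "q x > 0" for x
  proof -
    have "(norm (dq x))\<^sup>2 = (\<Sum>e\<in>B. (2 * ((x - a) \<bullet> e)) * (dq x \<bullet> e))"
      unfolding power2_norm_eq_inner by (subst (2) dq_def) (simp add: inner_sum_right)
    also have "\<dots> = 4 * q x"
      by (simp add: dq_def orthonormal_coeff[OF B] q_def power2_eq_square sum_distrib_left mult_ac)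
    finally have "inverse ((q x)\<^sup>2) * (norm (dq x))\<^sup>2 = inverse (q x) * 4"
      using that by (simp add: power2_eq_square field_simps)
    moreover have "inverse (q x) * 4 \<le> inverse (q x) * (2 * real (card B))"
      using that \<open>card B \<ge> 2\<close> by (intro mult_left_mono) auto
    ultimately show ?thesis by simp
  qed
  moreover have "(- inverse (q x)) *\<^sub>R dq x \<bullet> n = 0" if "n \<in> span B" "(x - a) \<bullet> n = 0" for x n
  proof -
    have "dq x = 2 *\<^sub>R (\<Sum>e\<in>B. ((x - a) \<bullet> e) *\<^sub>R e)" by (simp add: dq_def scaleR_sum_right)
    then show ?thesis using orthonormal_inner_span[OF B that(1), of "x - a"] that(2) by simp
  qed
  ultimately show ?thesis by (rule that)
qed

lemma dim_ge_2_if_not_parallel: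
  fixes a c :: "'a::euclidean_space"
  assumes "norm a = 1" "norm c = 1" "a \<noteq> c" "a \<noteq> - c" "a \<in> S" "c \<in> S"
  shows "2 \<le> dim S"
proof -
  have "a \<notin> span {c}"
  proof
    assume "a \<in> span {c}"
    then obtain k where k: "a = k *\<^sub>R c" by (auto simp: span_singleton)
    then have "\<bar>k\<bar> = 1" using assms(1,2) by simp
    then show False using k assms(3,4) by (auto simp: abs_if split: if_splits)
  qed
  then have "independent {a, c}"
    using assms(2) by (auto simp: independent_insert)
  then have "card {a, c} \<le> dim S"
    using assms(5,6) by (intro independent_card_le_dim) auto
  then show ?thesis using assms(3) by simp
qed

section \<open>Second difference quotients and an identity for traces\<close>

definition second_difference :: "('a::real_vector \<Rightarrow> 'b::real_vector) \<Rightarrow> 'a \<Rightarrow> 'a \<Rightarrow> real \<Rightarrow> 'a \<Rightarrow> 'b" where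
  "second_difference f p q t x =
     inverse (t\<^sup>2) *\<^sub>R (f (x + (t *\<^sub>R p + t *\<^sub>R q)) - f (x + t *\<^sub>R p) - f (x + t *\<^sub>R q) + f x)"

lemma second_difference_commute: "second_difference f p q t x = second_difference f q p t x"
  by (simp add: second_difference_def algebra_simps)

text \<open>Gradients commute with translations, and a constant Laplacian cancels in
  \<open>c - c - c + c\<close>: difference quotients of a solution of the Poisson equation are
  harmonic.\<close>

lemma second_difference_has_grad_laplacian:
  assumes f: "has_grad_laplacian f g (\<lambda>x. c) U" and "open V"
    and "\<And>x. x \<in> V \<Longrightarrow> x + (t *\<^sub>R p + t *\<^sub>R q) \<in> U" "\<And>x. x \<in> V \<Longrightarrow> x + t *\<^sub>R p \<in> U"
    and "\<And>x. x \<in> V \<Longrightarrow> x + t *\<^sub>R q \<in> U" "V \<subseteq> U"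
  shows "has_grad_laplacian (second_difference f p q t) (second_difference g p q t) (\<lambda>x. 0) V"
proof -
  have "has_grad_laplacian
      (\<lambda>x. inverse (t\<^sup>2) * (f (x + (t *\<^sub>R p + t *\<^sub>R q)) - f (x + t *\<^sub>R p) - f (x + t *\<^sub>R q) + f x))
      (second_difference g p q t) (\<lambda>x. inverse (t\<^sup>2) * (c - c - c + c)) V"
    unfolding second_difference_def
    by (intro has_grad_laplacian_cmul has_grad_laplacian_add has_grad_laplacian_diff
          has_grad_laplacian_translate[OF f] has_grad_laplacian_subset[OF f] assms(2-))
  then show ?thesis by (simp add: second_difference_def[abs_def])
qed

lemma second_difference_continuous_on:
  fixes f :: "'a::real_normed_vector \<Rightarrow> 'b::real_normed_vector"
  assumes "continuous_on U f"
    and "\<And>x. x \<in> V \<Longrightarrow> x + (t *\<^sub>R p + t *\<^sub>R q) \<in> U" "\<And>x. x \<in> V \<Longrightarrow> x + t *\<^sub>R p \<in> U"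
    and "\<And>x. x \<in> V \<Longrightarrow> x + t *\<^sub>R q \<in> U" "V \<subseteq> U"
  shows "continuous_on V (second_difference f p q t)"
  unfolding second_difference_def
  by (intro continuous_intros continuous_on_compose2[OF assms(1)] continuous_on_subset[OF assms(1)])
     (use assms(2-) in auto)

text \<open>Since \<open>B - \<beta>\<close> annihilates \<open>n\<close>, projecting the argument
  of \<open>A\<close> off \<open>n\<close> does not change its pairing with
  \<open>B - \<beta>\<close>. For Hessians \<open>A\<close> and \<open>B\<close> this removes the
  normal direction at the price of a trace, which the equation prescribes.\<close>

lemma inner_maps_deflate:
  fixes A B :: "'a::euclidean_space \<Rightarrow> 'a"
  assumes "linear A" "linear B" "B n = \<beta> *\<^sub>R n"
  shows "(\<Sum>i\<in>Basis. A i \<bullet> B i) =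
    (\<Sum>i\<in>Basis. A (i - (i \<bullet> n) *\<^sub>R n) \<bullet> (B i - \<beta> *\<^sub>R i)) + \<beta> * (\<Sum>i\<in>Basis. A i \<bullet> i)"
proof -
  have "(\<Sum>i\<in>Basis. (i \<bullet> n) *\<^sub>R (B i - \<beta> *\<^sub>R i)) =
      B (\<Sum>i\<in>Basis. (n \<bullet> i) *\<^sub>R i) - \<beta> *\<^sub>R (\<Sum>i\<in>Basis. (n \<bullet> i) *\<^sub>R i)"
    by (simp add: linear_sum[OF assms(2)] linear_scale[OF assms(2)] scaleR_sum_right
        scaleR_diff_right sum_subtractf inner_commute mult.commute)
  then have 0: "(\<Sum>i\<in>Basis. (i \<bullet> n) *\<^sub>R (B i - \<beta> *\<^sub>R i)) = 0"
    by (simp add: euclidean_representation assms(3))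
  have "(\<Sum>i\<in>Basis. A (i - (i \<bullet> n) *\<^sub>R n) \<bullet> (B i - \<beta> *\<^sub>R i)) =
      (\<Sum>i\<in>Basis. A i \<bullet> (B i - \<beta> *\<^sub>R i)) - A n \<bullet> (\<Sum>i\<in>Basis. (i \<bullet> n) *\<^sub>R (B i - \<beta> *\<^sub>R i))"
    by (simp add: linear_diff[OF assms(1)] linear_scale[OF assms(1)] inner_diff_left
        sum_subtractf inner_sum_right)
  then show ?thesis
    by (simp add: 0 inner_diff_right sum_subtractf sum_distrib_left)
qed

section \<open>The maximum principle for the Hessian\<close>

text \<open>A coordinate-free form of the problem. \<open>G\<close> and \<open>H\<close> are
  continuous extensions to \<open>K\<close> of gradient and Hessian; they are derivatives only in
  \<Omega>, so every fact at the boundary has to come from a limit or from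
  \<open>neumann\<close>.\<close>

locale neumann_C2 =
  fixes I :: "'i set" and \<nu> :: "'i \<Rightarrow> 'a::euclidean_space" and b :: "'i \<Rightarrow> real"
    and \<mu> :: real and \<gamma> :: "'i \<Rightarrow> real"
    and v :: "'a \<Rightarrow> real" and G :: "'a \<Rightarrow> 'a" and H :: "'a \<Rightarrow> 'a \<Rightarrow> 'a"
    and \<Omega> K :: "'a set"
  assumes finite_I: "finite I" and norm_normal: "\<And>i. i \<in> I \<Longrightarrow> norm (\<nu> i) = 1"
    and \<Omega>_eq: "\<Omega> = {x. \<forall>i\<in>I. x \<bullet> \<nu> i < b i}" and K_eq: "K = {x. \<forall>i\<in>I. x \<bullet> \<nu> i \<le> b i}"
    and nonempty: "\<Omega> \<noteq> {}" and bounded_K: "bounded K"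
    and cont_v: "continuous_on K v" and cont_G: "continuous_on K G"
    and cont_H: "\<And>e. continuous_on K (\<lambda>x. H x e)" and linear_H: "\<And>x. linear (H x)"
    and deriv_v: "\<And>x. x \<in> \<Omega> \<Longrightarrow> (v has_derivative (\<lambda>e. e \<bullet> G x)) (at x)"
    and deriv_G: "\<And>x. x \<in> \<Omega> \<Longrightarrow> (G has_derivative H x) (at x)"
    and poisson: "\<And>x. x \<in> \<Omega> \<Longrightarrow> (\<Sum>i\<in>Basis. H x i \<bullet> i) = - \<mu>"
    and neumann: "\<And>x i. x \<in> K \<Longrightarrow> i \<in> I \<Longrightarrow> x \<bullet> \<nu> i = b i \<Longrightarrow> G x \<bullet> \<nu> i = - \<gamma> i"
begin

section \<open>Active faces and passage to the boundary\<close>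

definition active :: "'a \<Rightarrow> 'i set" where
  "active x = {i \<in> I. x \<bullet> \<nu> i = b i}"

lemma open_\<Omega>: "open \<Omega>"
proof -
  have "\<Omega> = (\<Inter>i\<in>I. {x. \<nu> i \<bullet> x < b i})" by (auto simp: \<Omega>_eq inner_commute)
  then show ?thesis using finite_I by (simp add: open_INT open_halfspace_lt)
qed

lemma compact_K: "compact K"
proof -
  have "K = (\<Inter>i\<in>I. {x. \<nu> i \<bullet> x \<le> b i})" by (auto simp: K_eq inner_commute)
  then have "closed K" by (simp add: closed_INT closed_halfspace_le)
  with bounded_K show ?thesis by (simp add: compact_eq_bounded_closed)
qed

lemma \<Omega>_subset_K: "\<Omega> \<subseteq> K"
  by (auto simp: \<Omega>_eq K_eq less_imp_le)

lemma active_empty_iff: "x \<in> K \<Longrightarrow> active x = {} \<longleftrightarrow> x \<in> \<Omega>"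
  by (force simp: \<Omega>_eq K_eq active_def less_le)

lemma toward_interior:
  assumes "x \<in> K" "y \<in> \<Omega>" "0 < s" "s \<le> 1"
  shows "x + s *\<^sub>R (y - x) \<in> \<Omega>"
proof -
  have "(x + s *\<^sub>R (y - x)) \<bullet> \<nu> i < b i" if "i \<in> I" for i
  proof -
    have "(1 - s) * (x \<bullet> \<nu> i) \<le> (1 - s) * b i" "s * (y \<bullet> \<nu> i) < s * b i"
      using assms that by (auto simp: \<Omega>_eq K_eq intro: mult_left_mono)
    then show ?thesis by (simp add: inner_add_left inner_diff_left algebra_simps)
  qed
  then show ?thesis by (simp add: \<Omega>_eq)
qed

lemma tendsto_toward_interior:
  fixes x y :: 'a
  shows "((\<lambda>s. x + s *\<^sub>R (y - x)) \<longlongrightarrow> x) (at_right 0)"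
proof -
  have "((\<lambda>s. x + s *\<^sub>R (y - x)) \<longlongrightarrow> x + 0 *\<^sub>R (y - x)) (at_right 0)"
    by (intro tendsto_intros)
  then show ?thesis by simp
qed

lemma eventually_toward_interior:
  assumes "x \<in> K" "y \<in> \<Omega>" "open U" "x \<in> U"
  shows "eventually (\<lambda>s. x + s *\<^sub>R (y - x) \<in> \<Omega> \<inter> U) (at_right 0)"
proof -
  have "eventually (\<lambda>s::real. s \<in> {0<..<1}) (at_right 0)"
    by (rule eventually_at_right_real) simp
  moreover have "eventually (\<lambda>s. x + s *\<^sub>R (y - x) \<in> U) (at_right 0)"
    using tendsto_toward_interior assms(3,4) by (rule topological_tendstoD)
  ultimately show ?thesis
    by eventually_elim (use toward_interior[OF assms(1,2)] in auto)
qed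

text \<open>By convexity the segment from \<open>x\<close> to an interior point lies in \<Omega>
  except for \<open>x\<close>, so \<open>x\<close> is a limit from inside. The open set
  \<open>U\<close> admits functions that are controlled only near \<open>x\<close>, such as
  difference quotients.\<close>

lemma le_on_K_if_le_on_\<Omega>:
  fixes f :: "'a \<Rightarrow> real"
  assumes "x \<in> K" "open U" "x \<in> U" "continuous_on (K \<inter> U) f" "\<And>z. z \<in> \<Omega> \<inter> U \<Longrightarrow> f z \<le> c"
  shows "f x \<le> c"
proof -
  obtain y where y: "y \<in> \<Omega>" using nonempty by blast
  note ev = eventually_toward_interior[OF assms(1) y assms(2,3)]
  have "((\<lambda>s. f (x + s *\<^sub>R (y - x))) \<longlongrightarrow> f x) (at_right 0)"
    using assms(1,3) ev \<Omega>_subset_K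
    by (intro continuous_on_tendsto_compose[OF assms(4) tendsto_toward_interior])
       (auto elim!: eventually_mono)
  then show ?thesis
    by (rule tendsto_upperbound) (use ev assms(5) in \<open>auto elim!: eventually_mono\<close>)
qed

lemma eq_on_K_if_eq_on_\<Omega>:
  fixes f :: "'a \<Rightarrow> real"
  assumes "x \<in> K" "continuous_on K f" "\<And>z. z \<in> \<Omega> \<Longrightarrow> f z = c"
  shows "f x = c"
proof (rule antisym)
  show "f x \<le> c"
    by (rule le_on_K_if_le_on_\<Omega>[where U = UNIV]) (use assms in auto)
  have "- f x \<le> - c"
    by (rule le_on_K_if_le_on_\<Omega>[where U = UNIV]) (use assms in \<open>auto intro: continuous_intros\<close>)
  then show "c \<le> f x" by simp
qed

lemma inactive_nearby:
  obtains r where "r > 0" "\<And>z i. dist z x < r \<Longrightarrow> i \<in> I \<Longrightarrow> i \<notin> active x \<Longrightarrow> x \<in> K \<Longrightarrow> z \<bullet> \<nu> i < b i"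
proof -
  have "eventually (\<lambda>z. \<forall>i\<in>{i\<in>I. x \<bullet> \<nu> i < b i}. z \<bullet> \<nu> i < b i) (nhds x)"
    using finite_I by (intro eventually_ball_finite)
      (auto intro!: order_tendstoD(2)[of _ "x \<bullet> _"] tendsto_intros filterlim_ident)
  then obtain r where "r > 0" "\<And>z. dist z x < r \<Longrightarrow> \<forall>i\<in>{i\<in>I. x \<bullet> \<nu> i < b i}. z \<bullet> \<nu> i < b i"
    by (auto simp: eventually_nhds_metric)
  moreover have "x \<bullet> \<nu> i < b i" if "i \<in> I" "i \<notin> active x" "x \<in> K" for i
    using that unfolding active_def K_eq by fastforce
  ultimately show ?thesis by (intro that[of r]) blast+
qed

section \<open>Symmetry and trace of the Hessian up to the boundary\<close>

lemma cont_H_inner: "continuous_on K (\<lambda>x. H x p \<bullet> q)"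
  by (intro continuous_intros cont_H)

lemma v_has_grad_laplacian: "has_grad_laplacian v G (\<lambda>x. - \<mu>) \<Omega>"
  unfolding has_grad_laplacian_def
proof (intro conjI ballI)
  fix x assume x: "x \<in> \<Omega>"
  show "\<exists>D. (G has_derivative D) (at x) \<and> - \<mu> = (\<Sum>i\<in>Basis. D i \<bullet> i)"
    using deriv_G[OF x] poisson[OF x] by auto
qed (use open_\<Omega> deriv_v in auto)

text \<open>The mean value theorem is applied in direction \<open>p\<close> to a difference of
  \<open>v\<close>, then in direction \<open>q\<close> to \<open>G \<bullet> p\<close>. The quotient
  thus equals a value of the Hessian on the parallelogram, which yields both the symmetry of
  \<open>H\<close> and uniform convergence of the quotients.\<close>

lemma second_difference_mean_value:
  assumes "t > 0" and seg: "\<And>s s'. 0 \<le> s \<Longrightarrow> s \<le> t \<Longrightarrow> 0 \<le> s' \<Longrightarrow> s' \<le> t \<Longrightarrow> x + s *\<^sub>R p + s' *\<^sub>R q \<in> \<Omega>"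
  obtains s s' where "0 \<le> s" "s \<le> t" "0 \<le> s'" "s' \<le> t"
    "second_difference v p q t x = H (x + s *\<^sub>R p + s' *\<^sub>R q) q \<bullet> p"
proof -
  define F where "F s = v (x + s *\<^sub>R p + t *\<^sub>R q) - v (x + s *\<^sub>R p + 0 *\<^sub>R q)" for s
  have line: "((\<lambda>s. x + s *\<^sub>R p + s' *\<^sub>R q) has_derivative (\<lambda>h. h *\<^sub>R p)) (at s)"
    "((\<lambda>s'. x + s *\<^sub>R p + s' *\<^sub>R q) has_derivative (\<lambda>h. h *\<^sub>R q)) (at s')" for s s' :: real
    by (auto intro!: derivative_eq_intros)
  have dF: "(F has_real_derivative G (x + s *\<^sub>R p + t *\<^sub>R q) \<bullet> p - G (x + s *\<^sub>R p + 0 *\<^sub>R q) \<bullet> p) (at s)"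
    if "0 \<le> s" "s \<le> t" for s
  proof -
    have "(F has_derivative (\<lambda>h. (h *\<^sub>R p) \<bullet> G (x + s *\<^sub>R p + t *\<^sub>R q) - (h *\<^sub>R p) \<bullet> G (x + s *\<^sub>R p + 0 *\<^sub>R q))) (at s)"
      unfolding F_def using that \<open>t > 0\<close>
      by (intro has_derivative_diff has_derivative_compose[OF line(1) deriv_v] seg) auto
    moreover have "(\<lambda>h. (h *\<^sub>R p) \<bullet> G (x + s *\<^sub>R p + t *\<^sub>R q) - (h *\<^sub>R p) \<bullet> G (x + s *\<^sub>R p + 0 *\<^sub>R q))
        = (*) (G (x + s *\<^sub>R p + t *\<^sub>R q) \<bullet> p - G (x + s *\<^sub>R p + 0 *\<^sub>R q) \<bullet> p)"
      by (simp add: fun_eq_iff inner_commute algebra_simps)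
    ultimately show ?thesis
      by (simp only: has_field_derivative_def)
  qed
  from MVT2[OF \<open>t > 0\<close> dF]
  obtain s where s: "0 < s" "s < t"
    and Fs: "F t - F 0 = (t - 0) * (G (x + s *\<^sub>R p + t *\<^sub>R q) \<bullet> p - G (x + s *\<^sub>R p + 0 *\<^sub>R q) \<bullet> p)" by blast
  have dG: "((\<lambda>s'. G (x + s *\<^sub>R p + s' *\<^sub>R q) \<bullet> p) has_real_derivative H (x + s *\<^sub>R p + s' *\<^sub>R q) q \<bullet> p) (at s')"
    if "0 \<le> s'" "s' \<le> t" for s'
  proof -
    have "((\<lambda>s'. G (x + s *\<^sub>R p + s' *\<^sub>R q) \<bullet> p) has_derivative (\<lambda>h. H (x + s *\<^sub>R p + s' *\<^sub>R q) (h *\<^sub>R q) \<bullet> p)) (at s')"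
      using that s by (intro has_derivative_inner_left has_derivative_compose[OF line(2) deriv_G] seg) auto
    then show ?thesis
      by (simp add: has_field_derivative_def linear_scale[OF linear_H] mult.commute[of _ "_ \<bullet> _"])
  qed
  from MVT2[OF \<open>t > 0\<close> dG]
  obtain s' where s': "0 < s'" "s' < t"
    and Gs: "G (x + s *\<^sub>R p + t *\<^sub>R q) \<bullet> p - G (x + s *\<^sub>R p + 0 *\<^sub>R q) \<bullet> p = (t - 0) * (H (x + s *\<^sub>R p + s' *\<^sub>R q) q \<bullet> p)" by blast
  have "second_difference v p q t x = inverse (t\<^sup>2) * (F t - F 0)"
    by (simp add: second_difference_def F_def add.assoc)
  also have "\<dots> = H (x + s *\<^sub>R p + s' *\<^sub>R q) q \<bullet> p"
    unfolding Fs Gs using \<open>t > 0\<close> by (simp add: power2_eq_square field_simps)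
  finally show ?thesis using s s' by (intro that[of s s']) auto
qed

text \<open>The second difference is symmetric in \<open>p\<close> and \<open>q\<close>, so its two
  mean value representations agree; by continuity they approach the two sides as \<open>t\<close>
  shrinks.\<close>

lemma symmetric_H_interior:
  assumes "x \<in> \<Omega>"
  shows "H x p \<bullet> q = H x q \<bullet> p"
proof (rule ccontr)
  assume ne: "H x p \<bullet> q \<noteq> H x q \<bullet> p"
  define e where "e = \<bar>H x p \<bullet> q - H x q \<bullet> p\<bar> / 2"
  have "e > 0" using ne by (simp add: e_def)
  have close: "\<exists>d>0. \<forall>z. dist z x < d \<longrightarrow> z \<in> \<Omega> \<and> \<bar>H z p \<bullet> q - H x p \<bullet> q\<bar> < e" for p q
  proof -
    have "isCont (\<lambda>z. H z p \<bullet> q) x"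
      using continuous_on_subset[OF cont_H_inner \<Omega>_subset_K] open_\<Omega> assms
      by (simp add: continuous_on_eq_continuous_at)
    then have "eventually (\<lambda>z. dist (H z p \<bullet> q) (H x p \<bullet> q) < e) (nhds x)"
      using \<open>e > 0\<close> by (auto simp: continuous_at_eps_delta eventually_nhds_metric dist_real_def)
    moreover have "eventually (\<lambda>z. z \<in> \<Omega>) (nhds x)"
      using open_\<Omega> assms by (rule eventually_nhds_in_open)
    ultimately have "eventually (\<lambda>z. z \<in> \<Omega> \<and> \<bar>H z p \<bullet> q - H x p \<bullet> q\<bar> < e) (nhds x)"
      by eventually_elim (auto simp: dist_real_def)
    then show ?thesis by (auto simp: eventually_nhds_metric)
  qed
  obtain d1 where d1: "d1 > 0" "\<And>z. dist z x < d1 \<Longrightarrow> z \<in> \<Omega> \<and> \<bar>H z p \<bullet> q - H x p \<bullet> q\<bar> < e"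
    using close by blast
  obtain d2 where d2: "d2 > 0" "\<And>z. dist z x < d2 \<Longrightarrow> z \<in> \<Omega> \<and> \<bar>H z q \<bullet> p - H x q \<bullet> p\<bar> < e"
    using close by blast
  define C where "C = norm p + norm q + 1"
  define t where "t = min d1 d2 / (2 * C)"
  have "C > 0" by (simp add: C_def add_nonneg_pos)
  then have t: "t > 0" "t * C < d1" "t * C < d2"
    using d1(1) d2(1) by (auto simp: t_def min_def)
  have near: "dist (x + s *\<^sub>R p' + s' *\<^sub>R q') x \<le> t * C"
    if "0 \<le> s" "s \<le> t" "0 \<le> s'" "s' \<le> t" "norm p' + norm q' + 1 = C" for s s' p' q'
  proof -
    have "norm (s *\<^sub>R p' + s' *\<^sub>R q') \<le> s * norm p' + s' * norm q'"
      using that by (metis abs_of_nonneg norm_scaleR norm_triangle_ineq)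
    also have "\<dots> \<le> t * norm p' + t * norm q'"
      using that by (intro add_mono mult_right_mono) auto
    also have "\<dots> \<le> t * C" using t(1) by (simp add: that(5)[symmetric] algebra_simps)
    finally show ?thesis by (simp add: dist_norm add.assoc)
  qed
  obtain s1 s1' where 1: "0 \<le> s1" "s1 \<le> t" "0 \<le> s1'" "s1' \<le> t"
    "second_difference v p q t x = H (x + s1 *\<^sub>R p + s1' *\<^sub>R q) q \<bullet> p"
    by (rule second_difference_mean_value[OF t(1), of x p q])
       (use near[of _ _ p q] d1(2) t in \<open>force simp: C_def\<close>)+
  obtain s2 s2' where 2: "0 \<le> s2" "s2 \<le> t" "0 \<le> s2'" "s2' \<le> t"
    "second_difference v q p t x = H (x + s2 *\<^sub>R q + s2' *\<^sub>R p) p \<bullet> q"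
    by (rule second_difference_mean_value[OF t(1), of x q p])
       (use near[of _ _ q p] d1(2) t in \<open>force simp: C_def\<close>)+
  have "\<bar>H (x + s1 *\<^sub>R p + s1' *\<^sub>R q) q \<bullet> p - H x q \<bullet> p\<bar> < e"
    using near[OF 1(1-4), of p q] t by (intro conjunct2[OF d2(2)]) (simp add: C_def)
  moreover have "\<bar>H (x + s2 *\<^sub>R q + s2' *\<^sub>R p) p \<bullet> q - H x p \<bullet> q\<bar> < e"
    using near[OF 2(1-4), of q p] t by (intro conjunct2[OF d1(2)]) (simp add: C_def add.commute)
  moreover have "H (x + s1 *\<^sub>R p + s1' *\<^sub>R q) q \<bullet> p = H (x + s2 *\<^sub>R q + s2' *\<^sub>R p) p \<bullet> q"
    using 1(5) 2(5) second_difference_commute[of v p q t x] by simp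
  ultimately have "\<bar>H x p \<bullet> q - H x q \<bullet> p\<bar> < 2 * e" by linarith
  then show False by (simp add: e_def)
qed

lemma symmetric_H:
  assumes "x \<in> K"
  shows "H x p \<bullet> q = H x q \<bullet> p"
proof -
  have "H x p \<bullet> q - H x q \<bullet> p = 0"
    by (rule eq_on_K_if_eq_on_\<Omega>[OF assms])
       (auto intro!: continuous_intros cont_H simp: symmetric_H_interior)
  then show ?thesis by simp
qed

lemma trace_H:
  assumes "x \<in> K"
  shows "(\<Sum>i\<in>Basis. H x i \<bullet> i) = - \<mu>"
  by (rule eq_on_K_if_eq_on_\<Omega>[OF assms]) (auto intro!: continuous_intros cont_H simp: poisson)

section \<open>Comparison for linear functionals of the Hessian\<close>

lemma finite_uniform_modulus:
  assumes "finite F" "e > 0"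
  obtains \<delta> where "\<delta> > 0"
    "\<And>k x y. k \<in> F \<Longrightarrow> x \<in> K \<Longrightarrow> y \<in> K \<Longrightarrow> dist y x < \<delta> \<Longrightarrow> \<bar>H y (p k) \<bullet> q k - H x (p k) \<bullet> q k\<bar> < e"
proof -
  have "\<exists>\<delta>>0. \<forall>k\<in>F. \<forall>x\<in>K. \<forall>y\<in>K. dist y x < \<delta> \<longrightarrow> \<bar>H y (p k) \<bullet> q k - H x (p k) \<bullet> q k\<bar> < e"
    using assms(1)
  proof (induction F)
    case empty
    then show ?case by (auto intro: exI[of _ 1])
  next
    case (insert k F)
    obtain d where d: "d > 0" "\<forall>k\<in>F. \<forall>x\<in>K. \<forall>y\<in>K. dist y x < d \<longrightarrow> \<bar>H y (p k) \<bullet> q k - H x (p k) \<bullet> q k\<bar> < e"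
      using insert.IH by blast
    have "uniformly_continuous_on K (\<lambda>x. H x (p k) \<bullet> q k)"
      using cont_H_inner compact_K by (rule compact_uniformly_continuous)
    then obtain d' where d': "d' > 0"
      "\<forall>x\<in>K. \<forall>y\<in>K. dist y x < d' \<longrightarrow> \<bar>H y (p k) \<bullet> q k - H x (p k) \<bullet> q k\<bar> < e"
      using \<open>e > 0\<close> unfolding uniformly_continuous_on_def dist_real_def by blast
    show ?case
      by (rule exI[of _ "min d d'"]) (use d d' in auto)
  qed
  then show ?thesis using that by blast
qed

text \<open>The shift leaves \<open>x \<bullet> \<nu> i\<close> unchanged for faces active at
  \<open>x1\<close>, and every other constraint is strict throughout the ball. The base point
  \<open>x\<close> itself may be any point, not only \<open>x1\<close>.\<close>

lemma tangential_segment: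
  assumes "x1 \<in> K" "\<And>i. i \<in> active x1 \<Longrightarrow> e \<bullet> \<nu> i = 0"
    and near: "\<And>z i. dist z x1 < r \<Longrightarrow> i \<in> I \<Longrightarrow> i \<notin> active x1 \<Longrightarrow> z \<bullet> \<nu> i < b i"
    and "dist (x + e) x1 < r"
  shows "x \<in> \<Omega> \<Longrightarrow> x + e \<in> \<Omega>" and "x \<in> K \<Longrightarrow> x + e \<in> K"
proof -
  have *: "(x + e) \<bullet> \<nu> i = x \<bullet> \<nu> i" if "i \<in> active x1" for i
    using assms(2)[OF that] by (simp add: inner_add_left)
  have **: "(x + e) \<bullet> \<nu> i < b i" if "i \<in> I" "i \<notin> active x1" for i
    using near that assms(4) by blast
  show "x \<in> \<Omega> \<Longrightarrow> x + e \<in> \<Omega>"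
    unfolding \<Omega>_eq using * ** by force
  show "x \<in> K \<Longrightarrow> x + e \<in> K"
    unfolding K_eq using * ** by (force intro: less_imp_le)
qed

text \<open>A small multiple of |x - x1|^2 makes the maximum at \<open>x1\<close> strict, so that it
  survives a uniformly small perturbation. Its gradient vanishes at \<open>x1\<close>, hence the
  normal derivatives there keep their sign, and continuity carries all signs to a ball.\<close>

lemma strict_test_function:
  assumes \<phi>: "has_grad_laplacian \<phi> g L U" "x1 \<in> U" "L x1 < 0"
    and g: "\<And>i. i \<in> active x1 \<Longrightarrow> g x1 \<bullet> \<nu> i > 0"
  obtains \<eta> r g' L' where "\<eta> > 0" "r > 0"
    "has_grad_laplacian (\<lambda>x. \<phi> x + \<eta> * (norm (x - x1))\<^sup>2) g' L' U"
    "\<forall>x. dist x x1 < r \<longrightarrow> x \<in> U \<and> L' x < 0 \<and> (\<forall>i\<in>active x1. g' x \<bullet> \<nu> i > 0)"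
proof -
  have oU: "open U" by (rule has_grad_laplacianD(1)[OF \<phi>(1)])
  \<comment> \<open>The added Laplacian is 2 \<eta> times the dimension; this choice spends half of
    the margin \<open>- L x1\<close>.\<close>
  define \<eta> where "\<eta> = - L x1 / (4 * DIM('a))"
  have "\<eta> > 0" using \<phi>(3) by (simp add: \<eta>_def divide_neg_pos)
  define g' where "g' x = g x + \<eta> *\<^sub>R (2 *\<^sub>R (x - x1))" for x
  define L' where "L' x = L x + \<eta> * (2 * DIM('a))" for x
  have \<phi>': "has_grad_laplacian (\<lambda>x. \<phi> x + \<eta> * (norm (x - x1))\<^sup>2) g' L' U"
    unfolding g'_def L'_def
    by (rule has_grad_laplacian_add[OF \<phi>(1) has_grad_laplacian_cmul[OF
          has_grad_laplacian_subset[OF has_grad_laplacian_norm_square subset_UNIV oU]]])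
  have "\<eta> * (2 * DIM('a)) = - L x1 / 2" by (simp add: \<eta>_def field_simps)
  then have L'1: "L' x1 < 0" unfolding L'_def using \<phi>(3) by simp
  have g'1: "g' x1 \<bullet> \<nu> i > 0" if "i \<in> active x1" for i
    using g[OF that] by (simp add: g'_def)
  have "isCont L' x1" "isCont g' x1"
    using has_grad_laplacianD(2,4)[OF \<phi>'] oU \<phi>(2) by (auto simp: continuous_on_eq_continuous_at)
  then have lim: "(L' \<longlongrightarrow> L' x1) (nhds x1)" "(g' \<longlongrightarrow> g' x1) (nhds x1)"
    by (simp_all add: isCont_def tendsto_at_iff_tendsto_nhds)
  have "eventually (\<lambda>x. x \<in> U) (nhds x1)" using oU \<phi>(2) by (rule eventually_nhds_in_open)
  moreover have "eventually (\<lambda>x. L' x < 0) (nhds x1)" using lim(1) L'1 by (rule order_tendstoD)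
  moreover have "eventually (\<lambda>x. \<forall>i\<in>active x1. g' x \<bullet> \<nu> i > 0) (nhds x1)"
  proof (rule eventually_ball_finite)
    show "finite (active x1)" using finite_I by (simp add: active_def)
    show "\<forall>i\<in>active x1. eventually (\<lambda>x. g' x \<bullet> \<nu> i > 0) (nhds x1)"
      using order_tendstoD(1)[OF tendsto_inner[OF lim(2) tendsto_const] g'1] by blast
  qed
  ultimately have "eventually (\<lambda>x. x \<in> U \<and> L' x < 0 \<and> (\<forall>i\<in>active x1. g' x \<bullet> \<nu> i > 0)) (nhds x1)"
    by (intro eventually_conj)
  then obtain r1 where r1: "r1 > 0"
    "\<And>x. dist x x1 < r1 \<Longrightarrow> x \<in> U \<and> L' x < 0 \<and> (\<forall>i\<in>active x1. g' x \<bullet> \<nu> i > 0)"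
    by (auto simp: eventually_nhds_metric)
  show ?thesis by (rule that[OF \<open>\<eta> > 0\<close> r1(1) \<phi>']) (use r1(2) in blast)+
qed

text \<open>Difference quotients along tangential directions never leave \<open>K\<close> and have vanishing normal
  derivative on the face, so they are comparable with test functions although \<open>v\<close> is only \<open>C\<^sup>2\<close>.\<close>

lemma no_touching_linear:
  fixes p q :: "'k \<Rightarrow> 'a"
  assumes x1: "x1 \<in> K" and "finite F"
    and p: "\<And>k i. k \<in> F \<Longrightarrow> i \<in> active x1 \<Longrightarrow> p k \<bullet> \<nu> i = 0"
    and q: "\<And>k i. k \<in> F \<Longrightarrow> i \<in> active x1 \<Longrightarrow> q k \<bullet> \<nu> i = 0"
    and single: "\<And>i j. i \<in> active x1 \<Longrightarrow> j \<in> active x1 \<Longrightarrow> \<nu> i = \<nu> j"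
    and \<phi>: "has_grad_laplacian \<phi> g L U" "x1 \<in> U" "L x1 < 0"
    and g: "\<And>i. i \<in> active x1 \<Longrightarrow> g x1 \<bullet> \<nu> i > 0"
    and "d > 0"
    and max: "\<And>x. x \<in> K \<Longrightarrow> dist x x1 < d \<Longrightarrow>
      (\<Sum>k\<in>F. H x (p k) \<bullet> q k) - \<phi> x \<le> (\<Sum>k\<in>F. H x1 (p k) \<bullet> q k) - \<phi> x1"
  shows False
proof -
  define w where "w x = (\<Sum>k\<in>F. H x (p k) \<bullet> q k)" for x
  obtain \<eta> r1 g' L' where \<eta>: "\<eta> > 0" and r1: "r1 > 0"
    and \<phi>'0: "has_grad_laplacian (\<lambda>x. \<phi> x + \<eta> * (norm (x - x1))\<^sup>2) g' L' U"
    and test: "\<forall>x. dist x x1 < r1 \<longrightarrow> x \<in> U \<and> L' x < 0 \<and> (\<forall>i\<in>active x1. g' x \<bullet> \<nu> i > 0)"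
    using strict_test_function[OF \<phi> g] by blast
  define \<phi>' where "\<phi>' x = \<phi> x + \<eta> * (norm (x - x1))\<^sup>2" for x
  have \<phi>': "has_grad_laplacian \<phi>' g' L' U" unfolding \<phi>'_def by (rule \<phi>'0)
  obtain r2 where r2: "r2 > 0" "\<And>z i. dist z x1 < r2 \<Longrightarrow> i \<in> I \<Longrightarrow> i \<notin> active x1 \<Longrightarrow> z \<bullet> \<nu> i < b i"
    using inactive_nearby[of x1] x1 by metis
  \<comment> \<open>Three nested balls: maximization over radius \<open>R\<close>, difference
    quotients on radius 2 R, their shifted arguments within radius 3 R.\<close>
  define R where "R = min (min r1 r2) d / 3"
  have R: "R > 0" "3 * R \<le> r1" "3 * R \<le> r2" "3 * R \<le> d"
    using r1 r2(1) \<open>d > 0\<close> unfolding R_def by linarith+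
  have U: "x \<in> U" and neg: "L' x < 0" and pos: "i \<in> active x1 \<Longrightarrow> g' x \<bullet> \<nu> i > 0"
    if "dist x x1 < 3 * R" for x i
    using test that R by auto
  \<comment> \<open>Replacing \<open>w\<close> by quotients within \<epsilon> of it costs at most 2
    \<epsilon>, less than the drop \<eta> R^2 of the quadratic term on the sphere of radius
    \<open>R\<close>.\<close>
  define \<epsilon> where "\<epsilon> = \<eta> * R\<^sup>2 / 3"
  have "\<epsilon> > 0" using \<open>\<eta> > 0\<close> R(1) by (simp add: \<epsilon>_def)
  define \<epsilon>1 where "\<epsilon>1 = \<epsilon> / (card F + 1)"
  have "\<epsilon>1 > 0" using \<open>\<epsilon> > 0\<close> by (simp add: \<epsilon>1_def)
  obtain \<delta> where \<delta>: "\<delta> > 0" "\<And>k x y. k \<in> F \<Longrightarrow> x \<in> K \<Longrightarrow> y \<in> K \<Longrightarrow> dist y x < \<delta> \<Longrightarrow>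
      \<bar>H y (p k) \<bullet> q k - H x (p k) \<bullet> q k\<bar> < \<epsilon>1"
    using finite_uniform_modulus[OF \<open>finite F\<close> \<open>\<epsilon>1 > 0\<close>, of p q] by blast
  define C where "C = (\<Sum>k\<in>F. norm (p k) + norm (q k)) + 1"
  have C: "norm (p k) + norm (q k) \<le> C" if "k \<in> F" for k
    using member_le_sum[OF that, of "\<lambda>k. norm (p k) + norm (q k)"] \<open>finite F\<close> by (simp add: C_def)
  have "C > 0" unfolding C_def by (intro add_nonneg_pos sum_nonneg) auto
  \<comment> \<open>Every shift then has length at most \<open>t * C\<close>, which is below both
    the modulus \<delta> and the spare radius \<open>R\<close>.\<close>
  define t where "t = min \<delta> R / (2 * C)"
  have "t > 0" using \<open>\<delta> > 0\<close> R(1) \<open>C > 0\<close> by (simp add: t_def)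
  have "t * C = min \<delta> R / 2" using \<open>C > 0\<close> by (simp add: t_def)
  then have t: "t > 0" "t * C < \<delta>" "t * C < R"
    using \<open>t > 0\<close> \<open>\<delta> > 0\<close> R(1) by linarith+
  have small: "norm (s *\<^sub>R p k + s' *\<^sub>R q k) \<le> t * C"
    if "0 \<le> s" "s \<le> t" "0 \<le> s'" "s' \<le> t" "k \<in> F" for s s' k
  proof -
    have "norm (s *\<^sub>R p k + s' *\<^sub>R q k) \<le> norm (s *\<^sub>R p k) + norm (s' *\<^sub>R q k)"
      by (rule norm_triangle_ineq)
    also have "\<dots> \<le> t * norm (p k) + t * norm (q k)"
      using that by (auto intro!: add_mono mult_right_mono)
    also have "\<dots> \<le> t * C" using C[OF that(5)] \<open>t > 0\<close> by (simp add: distrib_left[symmetric])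
    finally show ?thesis .
  qed
  have shift: "dist (x + (s *\<^sub>R p k + s' *\<^sub>R q k)) x1 < 3 * R"
    "x \<in> \<Omega> \<Longrightarrow> x + (s *\<^sub>R p k + s' *\<^sub>R q k) \<in> \<Omega>" "x \<in> K \<Longrightarrow> x + (s *\<^sub>R p k + s' *\<^sub>R q k) \<in> K"
    if "dist x x1 < 2 * R" "0 \<le> s" "s \<le> t" "0 \<le> s'" "s' \<le> t" "k \<in> F" for x s s' k
  proof -
    have "dist (x + (s *\<^sub>R p k + s' *\<^sub>R q k)) x \<le> t * C"
      using small[OF that(2-6)] by (simp add: dist_norm)
    then show *: "dist (x + (s *\<^sub>R p k + s' *\<^sub>R q k)) x1 < 3 * R"
      using dist_triangle[of "x + (s *\<^sub>R p k + s' *\<^sub>R q k)" x1 x] that(1) t(3) by linarith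
    have tan: "(s *\<^sub>R p k + s' *\<^sub>R q k) \<bullet> \<nu> i = 0" if "i \<in> active x1" for i
      using p q that \<open>k \<in> F\<close> by (simp add: inner_add_left)
    have **: "dist (x + (s *\<^sub>R p k + s' *\<^sub>R q k)) x1 < r2" using * R(3) by linarith
    show "x \<in> \<Omega> \<Longrightarrow> x + (s *\<^sub>R p k + s' *\<^sub>R q k) \<in> \<Omega>" "x \<in> K \<Longrightarrow> x + (s *\<^sub>R p k + s' *\<^sub>R q k) \<in> K"
      using tangential_segment[OF x1 tan r2(2) **] by blast+
  qed
  have shift\<Omega>: "x + (t *\<^sub>R p k + t *\<^sub>R q k) \<in> \<Omega>" "x + t *\<^sub>R p k \<in> \<Omega>" "x + t *\<^sub>R q k \<in> \<Omega>"
    if "x \<in> \<Omega> \<inter> ball x1 (2 * R)" "k \<in> F" for x k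
    using shift(2)[of x t t k] shift(2)[of x t 0 k] shift(2)[of x 0 t k] that t(1)
    by (auto simp: dist_commute)
  have shiftK: "x + (t *\<^sub>R p k + t *\<^sub>R q k) \<in> K" "x + t *\<^sub>R p k \<in> K" "x + t *\<^sub>R q k \<in> K"
    if "x \<in> K \<inter> ball x1 (2 * R)" "k \<in> F" for x k
    using shift(3)[of x t t k] shift(3)[of x t 0 k] shift(3)[of x 0 t k] that t(1)
    by (auto simp: dist_commute)
  define wt where "wt x = (\<Sum>k\<in>F. second_difference v (p k) (q k) t x)" for x
  define gt where "gt x = (\<Sum>k\<in>F. second_difference G (p k) (q k) t x)" for x
  have hgl_wt: "has_grad_laplacian wt gt (\<lambda>x. 0) (\<Omega> \<inter> ball x1 (2 * R))"
  proof -
    have "has_grad_laplacian wt gt (\<lambda>x. \<Sum>k\<in>F. 0) (\<Omega> \<inter> ball x1 (2 * R))"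
      unfolding wt_def gt_def
      by (intro has_grad_laplacian_sum \<open>finite F\<close>
            second_difference_has_grad_laplacian[OF v_has_grad_laplacian])
         (use shift\<Omega> open_\<Omega> in auto)
    then show ?thesis by simp
  qed
  have cont_wt: "continuous_on (K \<inter> ball x1 (2 * R)) wt"
    unfolding wt_def
    by (intro continuous_on_sum second_difference_continuous_on[OF cont_v]) (use shiftK in auto)
  have cont_gt: "continuous_on (K \<inter> ball x1 (2 * R)) gt"
    unfolding gt_def
    by (intro continuous_on_sum second_difference_continuous_on[OF cont_G]) (use shiftK in auto)
  have cont_w: "continuous_on K w" unfolding w_def by (intro continuous_on_sum cont_H_inner)
  have approx_interior: "\<bar>wt x - w x\<bar> \<le> \<epsilon>" if x: "x \<in> \<Omega> \<inter> ball x1 (2 * R)" for x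
  proof -
    have "\<bar>second_difference v (p k) (q k) t x - H x (p k) \<bullet> q k\<bar> \<le> \<epsilon>1" if k: "k \<in> F" for k
    proof -
      have seg: "x + s *\<^sub>R p k + s' *\<^sub>R q k \<in> \<Omega>" if "0 \<le> s" "s \<le> t" "0 \<le> s'" "s' \<le> t" for s s'
        using shift(2)[OF _ that k, of x] x by (auto simp: add.assoc dist_commute)
      obtain s s' where s: "0 \<le> s" "s \<le> t" "0 \<le> s'" "s' \<le> t"
        "second_difference v (p k) (q k) t x = H (x + s *\<^sub>R p k + s' *\<^sub>R q k) (q k) \<bullet> p k"
        using second_difference_mean_value[OF t(1) seg] by blast
      let ?y = "x + s *\<^sub>R p k + s' *\<^sub>R q k"
      have y: "?y \<in> \<Omega>" by (rule seg[OF s(1-4)])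
      have "dist ?y x < \<delta>" using small[OF s(1-4) k] t(2) by (simp add: dist_norm add.assoc)
      then have "\<bar>H ?y (p k) \<bullet> q k - H x (p k) \<bullet> q k\<bar> < \<epsilon>1"
        using \<delta>(2)[OF k, of x ?y] x y \<Omega>_subset_K by blast
      then show ?thesis using symmetric_H_interior[OF y] s(5) by simp
    qed
    then have "\<bar>\<Sum>k\<in>F. second_difference v (p k) (q k) t x - H x (p k) \<bullet> q k\<bar> \<le> (\<Sum>k\<in>F. \<epsilon>1)"
      by (intro order.trans[OF sum_abs] sum_mono)
    also have "\<dots> \<le> \<epsilon>" using \<open>\<epsilon> > 0\<close> by (simp add: \<epsilon>1_def field_simps)
    finally show ?thesis by (simp add: wt_def w_def sum_subtractf)
  qed
  have approx: "\<bar>wt x - w x\<bar> \<le> \<epsilon>" if x: "x \<in> K" "dist x x1 < 2 * R" for x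
  proof (rule le_on_K_if_le_on_\<Omega>[OF x(1) open_ball])
    show "x \<in> ball x1 (2 * R)" using x by (simp add: dist_commute)
    show "continuous_on (K \<inter> ball x1 (2 * R)) (\<lambda>x. \<bar>wt x - w x\<bar>)"
      by (intro continuous_intros cont_wt continuous_on_subset[OF cont_w]) auto
  qed (rule approx_interior)
  define D where "D = K \<inter> cball x1 R"
  have D_sub: "D \<subseteq> K \<inter> ball x1 (2 * R)" "D \<subseteq> U"
    using R(1) U by (auto simp: D_def dist_commute)
  have "x1 \<in> D" using x1 R(1) by (simp add: D_def)
  have "compact D" unfolding D_def using compact_K by (simp add: compact_Int)
  moreover have "continuous_on D (\<lambda>x. wt x - \<phi>' x)"
    by (intro continuous_on_diff continuous_on_subset[OF cont_wt D_sub(1)]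
          continuous_on_subset[OF has_grad_laplacianD(3)[OF \<phi>'] D_sub(2)])
  ultimately obtain xt where xt: "xt \<in> D" "\<And>x. x \<in> D \<Longrightarrow> wt x - \<phi>' x \<le> wt xt - \<phi>' xt"
    using continuous_attains_sup[of D "\<lambda>x. wt x - \<phi>' x"] \<open>x1 \<in> D\<close> by blast
  have xtK: "xt \<in> K" and xtR: "dist xt x1 \<le> R" using xt(1) by (auto simp: D_def dist_commute)
  have "\<eta> * (norm (xt - x1))\<^sup>2 \<le> 2 * \<epsilon>"
  proof -
    have "w x1 - \<epsilon> \<le> wt x1" using approx[OF x1] R(1) by (simp add: abs_le_iff)
    moreover have "wt xt \<le> w xt + \<epsilon>" using approx[OF xtK] xtR R(1) by (simp add: abs_le_iff)
    moreover have "wt x1 - \<phi> x1 \<le> wt xt - (\<phi> xt + \<eta> * (norm (xt - x1))\<^sup>2)"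
      using xt(2)[OF \<open>x1 \<in> D\<close>] by (simp add: \<phi>'_def)
    moreover have "w xt - \<phi> xt \<le> w x1 - \<phi> x1"
      using max[OF xtK] xtR R unfolding w_def by simp
    ultimately show ?thesis by linarith
  qed
  also have "2 * \<epsilon> < \<eta> * R\<^sup>2" using \<open>\<epsilon> > 0\<close> by (simp add: \<epsilon>_def)
  finally have "(norm (xt - x1))\<^sup>2 < R\<^sup>2" using \<open>\<eta> > 0\<close> by simp
  then have xt_near: "dist xt x1 < R"
    using R(1) by (simp add: dist_norm power2_less_imp_less)
  show False
  proof (cases "xt \<in> \<Omega>")
    case True
    define V where "V = \<Omega> \<inter> ball x1 R"
    have "V \<subseteq> \<Omega> \<inter> ball x1 (2 * R)" "V \<subseteq> U" "open V"
      using R(1) U open_\<Omega> by (auto simp: V_def dist_commute)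
    then have h: "has_grad_laplacian (\<lambda>x. wt x - \<phi>' x) (\<lambda>x. gt x - g' x) (\<lambda>x. 0 - L' x) V"
      by (intro has_grad_laplacian_diff has_grad_laplacian_subset[OF hgl_wt] has_grad_laplacian_subset[OF \<phi>'])
    have "xt \<in> V" using True xt_near by (simp add: V_def dist_commute)
    then obtain e where e: "e > 0" "ball xt e \<subseteq> V" using \<open>open V\<close> openE by blast
    have "V \<subseteq> D" using \<Omega>_subset_K by (auto simp: V_def D_def)
    \<comment> \<open>\<open>wt\<close> is harmonic in the interior, so the Laplacian of
      \<open>wt - \<phi>'\<close> is \<open>- L'\<close>, which is positive.\<close>
    have "0 - L' xt \<le> 0"
      by (rule laplacian_nonpos_at_local_max[OF h \<open>xt \<in> V\<close> e(1)])
         (use xt(2) e(2) \<open>V \<subseteq> D\<close> in \<open>auto simp: dist_commute subset_iff\<close>)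
    then show False using neg[of xt] xt_near R(1) by simp
  next
    case False
    then obtain i where i: "i \<in> active xt" using active_empty_iff[OF xtK] by blast
    define n where "n = \<nu> i"
    have iI: "i \<in> I" and ib: "xt \<bullet> n = b i" using i by (auto simp: active_def n_def)
    have i1: "i \<in> active x1"
      using r2(2)[of xt i] xt_near R iI ib by (force simp: n_def)
    have norm_n: "norm n = 1" using norm_normal[OF iI] by (simp add: n_def)
    \<comment> \<open>All shifted points stay on the same face, so the four normal derivatives in
      each second difference are equal and cancel.\<close>
    have gt0: "gt xt \<bullet> n = 0"
    proof -
      have *: "G (xt + (s *\<^sub>R p k + s' *\<^sub>R q k)) \<bullet> n = - \<gamma> i"
        if "0 \<le> s" "s \<le> t" "0 \<le> s'" "s' \<le> t" "k \<in> F" for s s' k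
        unfolding n_def
      proof (rule neumann[OF _ iI])
        show "xt + (s *\<^sub>R p k + s' *\<^sub>R q k) \<in> K"
          using shift(3)[OF _ that xtK] xt_near R(1) by simp
        show "(xt + (s *\<^sub>R p k + s' *\<^sub>R q k)) \<bullet> \<nu> i = b i"
          using p[OF that(5) i1] q[OF that(5) i1] ib by (simp add: inner_add_left n_def)
      qed
      have "second_difference G (p k) (q k) t xt \<bullet> n = 0" if k: "k \<in> F" for k
        using *[of t t k] *[of t 0 k] *[of 0 t k] *[of 0 0 k] k t(1)
        by (simp add: second_difference_def inner_add_left inner_diff_left)
      then show ?thesis by (simp add: gt_def inner_sum_left)
    qed
    \<comment> \<open>By \<open>single\<close>, one direction \<open>n\<close> leads strictly inside
      all faces active at \<open>x1\<close>; the other constraints are strict in the ball.\<close>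
    have inward: "xt - s *\<^sub>R n \<in> \<Omega>" "dist (xt - s *\<^sub>R n) x1 < R" if "0 < s" "s < R - dist xt x1" for s
    proof -
      have "dist (xt - s *\<^sub>R n) xt = s" using that(1) norm_n by (simp add: dist_norm)
      then show near: "dist (xt - s *\<^sub>R n) x1 < R"
        using dist_triangle[of "xt - s *\<^sub>R n" x1 xt] that(2) by linarith
      have "(xt - s *\<^sub>R n) \<bullet> \<nu> j < b j" if j: "j \<in> I" for j
      proof (cases "j \<in> active x1")
        case True
        then have "\<nu> j = n" using single i1 unfolding n_def by blast
        moreover have "xt \<bullet> \<nu> j \<le> b j" using xtK j by (simp add: K_eq)
        ultimately show ?thesis
          using \<open>0 < s\<close> norm_n by (simp add: inner_diff_left norm_eq_1)
      next
        case False
        then show ?thesis using r2(2)[OF _ j] near R by simp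
      qed
      then show "xt - s *\<^sub>R n \<in> \<Omega>" by (simp add: \<Omega>_eq)
    qed
    have "continuous_on D (\<lambda>x. (g' x - gt x) \<bullet> n)"
      by (intro continuous_intros continuous_on_subset[OF cont_gt D_sub(1)]
            continuous_on_subset[OF has_grad_laplacianD(4)[OF \<phi>'] D_sub(2)])
    moreover have "(g' xt - gt xt) \<bullet> n > 0"
      using pos[OF _ i1, of xt] xt_near R(1) gt0 by (simp add: inner_diff_left n_def)
    ultimately have "\<exists>e>0. \<forall>x\<in>D. dist x xt < e \<longrightarrow>
        dist ((g' x - gt x) \<bullet> n) ((g' xt - gt xt) \<bullet> n) < (g' xt - gt xt) \<bullet> n"
      using xt(1) unfolding continuous_on_iff by blast
    then obtain e where e: "e > 0"
      "\<And>x. x \<in> D \<Longrightarrow> dist x xt < e \<Longrightarrow> (g' x - gt x) \<bullet> n > 0"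
      by (force simp: dist_real_def)
    obtain s0 where s0: "0 < s0" "s0 < e" "s0 < R - dist xt x1"
      using field_lbound_gt_zero[of e "R - dist xt x1"] e(1) xt_near by auto
    have inD: "xt - s *\<^sub>R n \<in> D" if "0 \<le> s" "s \<le> s0" for s
    proof (cases "s = 0")
      case False
      then have "xt - s *\<^sub>R n \<in> \<Omega>" "dist (xt - s *\<^sub>R n) x1 < R"
        using inward[of s] that s0 by auto
      then show ?thesis using \<Omega>_subset_K by (auto simp: D_def dist_commute)
    qed (use xt(1) in simp)
    \<comment> \<open>The inward derivative of \<open>wt - \<phi>'\<close> is positive near
      \<open>xt\<close>, contradicting the maximum. On the face itself only continuity is available,
      so monotonicity is derived from the open segment.\<close>
    have "wt (xt - 0 *\<^sub>R n) - \<phi>' (xt - 0 *\<^sub>R n) < wt (xt - s0 *\<^sub>R n) - \<phi>' (xt - s0 *\<^sub>R n)"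
    proof (rule DERIV_pos_imp_increasing_open[OF s0(1)])
      fix s assume s: "0 < s" "s < s0"
      let ?x = "xt - s *\<^sub>R n"
      have x: "?x \<in> \<Omega>" "dist ?x x1 < R" using inward[of s] s s0 by auto
      have "dist ?x xt < e" using s s0 norm_n by (simp add: dist_norm)
      then have D_pos: "(g' ?x - gt ?x) \<bullet> n > 0" using e(2) inD s by simp
      have line: "((\<lambda>s. xt - s *\<^sub>R n) has_derivative (\<lambda>h. - (h *\<^sub>R n))) (at s)"
        by (auto intro!: derivative_eq_intros)
      have "((\<lambda>s. wt (xt - s *\<^sub>R n) - \<phi>' (xt - s *\<^sub>R n)) has_derivative
          (\<lambda>h. (- (h *\<^sub>R n)) \<bullet> gt ?x - (- (h *\<^sub>R n)) \<bullet> g' ?x)) (at s)"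
        using x R(1) U
        by (intro has_derivative_diff has_derivative_compose[OF line has_grad_laplacianD(5)[OF hgl_wt]]
              has_derivative_compose[OF line has_grad_laplacianD(5)[OF \<phi>']]) (auto simp: dist_commute)
      moreover have "(\<lambda>h. (- (h *\<^sub>R n)) \<bullet> gt ?x - (- (h *\<^sub>R n)) \<bullet> g' ?x) = (*) ((g' ?x - gt ?x) \<bullet> n)"
        by (simp add: fun_eq_iff inner_diff_left inner_diff_right inner_commute algebra_simps)
      ultimately show "\<exists>y. ((\<lambda>s. wt (xt - s *\<^sub>R n) - \<phi>' (xt - s *\<^sub>R n)) has_real_derivative y) (at s) \<and> y > 0"
        using D_pos by (auto simp: has_field_derivative_def)
    next
      show "continuous_on {0..s0} (\<lambda>s. wt (xt - s *\<^sub>R n) - \<phi>' (xt - s *\<^sub>R n))"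
        by (rule continuous_on_compose2[of D "\<lambda>x. wt x - \<phi>' x" _ "\<lambda>s. xt - s *\<^sub>R n"])
           (use inD \<open>continuous_on D (\<lambda>x. wt x - \<phi>' x)\<close> in \<open>auto intro!: continuous_intros\<close>)
    qed
    then show False using xt(2)[OF inD, of s0] s0(1) by simp
  qed
qed

section \<open>Comparison for the squared norm of the Hessian\<close>

definition hessian_sq :: "'a \<Rightarrow> real" where
  "hessian_sq x = (\<Sum>i\<in>Basis. H x i \<bullet> H x i)"

lemma cont_hessian_sq: "continuous_on K hessian_sq"
  unfolding hessian_sq_def[abs_def] by (intro continuous_intros cont_H)

lemma hessian_sq_diff:
  "(\<Sum>i\<in>Basis. (H x i - H y i) \<bullet> (H x i - H y i)) =
     hessian_sq x + hessian_sq y - 2 * (\<Sum>i\<in>Basis. H x i \<bullet> H y i)"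
  by (simp add: hessian_sq_def inner_diff_left inner_diff_right inner_commute
      sum.distrib sum_subtractf sum_distrib_left algebra_simps)

text \<open>Convexity of the squared norm. There is equality for \<open>x = y\<close>, so a maximum
  of \<open>hessian_sq - \<phi>\<close> at \<open>y\<close> is also one for the linear functional
  \<open>2 * (\<Sum>i\<in>Basis. H x i \<bullet> H y i)\<close> minus \<phi>.\<close>

lemma hessian_sq_ge: "2 * (\<Sum>i\<in>Basis. H x i \<bullet> H y i) \<le> hessian_sq x + hessian_sq y"
  using sum_nonneg[of Basis "\<lambda>i. (H x i - H y i) \<bullet> (H x i - H y i)"] hessian_sq_diff[of x y] by simp

text \<open>Along the face \<open>G \<bullet> \<nu> i\<close> is constant. As \<open>G\<close> is
  differentiable only inside, a positive value would first force growth of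
  \<open>G \<bullet> \<nu> i\<close> by a fixed amount on parallel interior segments, and the limit
  at the face would contradict constancy.\<close>

lemma H_tangential_normal_le:
  assumes x: "x \<in> K" and i: "i \<in> active x"
    and single: "\<And>j. j \<in> active x \<Longrightarrow> \<nu> j = \<nu> i" and \<tau>: "\<tau> \<bullet> \<nu> i = 0"
  shows "H x \<tau> \<bullet> \<nu> i \<le> 0"
proof (rule ccontr)
  define n where "n = \<nu> i"
  define c where "c = H x \<tau> \<bullet> n"
  assume "\<not> H x \<tau> \<bullet> \<nu> i \<le> 0"
  then have "c > 0" by (simp add: c_def n_def)
  have "\<exists>d>0. \<forall>z\<in>K. dist z x < d \<longrightarrow> dist (H z \<tau> \<bullet> n) (H x \<tau> \<bullet> n) < c / 2"
    using cont_H_inner[of \<tau> n] x \<open>c > 0\<close> unfolding continuous_on_iff by (meson half_gt_zero)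
  then obtain r1 where r1: "r1 > 0"
    "\<And>z. z \<in> K \<Longrightarrow> dist z x < r1 \<Longrightarrow> dist (H z \<tau> \<bullet> n) c < c / 2"
    unfolding c_def by blast
  obtain r2 where r2: "r2 > 0" "\<And>z j. dist z x < r2 \<Longrightarrow> j \<in> I \<Longrightarrow> j \<notin> active x \<Longrightarrow> z \<bullet> \<nu> j < b j"
    using inactive_nearby[of x] x by metis
  define r where "r = min r1 r2 / 2"
  have r: "r > 0" "2 * r \<le> r1" "2 * r \<le> r2" using r1(1) r2(1) by (auto simp: r_def)
  define t where "t = r / (norm \<tau> + 1)"
  have "norm \<tau> + 1 > 0" by (simp add: add_nonneg_pos)
  then have t: "t > 0" "t * norm \<tau> \<le> r" using r(1) by (simp_all add: t_def field_simps)
  have seg: "dist (z + s *\<^sub>R \<tau>) x < 2 * r" "z \<in> \<Omega> \<Longrightarrow> z + s *\<^sub>R \<tau> \<in> \<Omega>" "z \<in> K \<Longrightarrow> z + s *\<^sub>R \<tau> \<in> K"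
    if "dist z x < r" "0 \<le> s" "s \<le> t" for z s
  proof -
    have "dist (z + s *\<^sub>R \<tau>) z \<le> t * norm \<tau>"
      using that by (simp add: dist_norm mult_right_mono)
    then show *: "dist (z + s *\<^sub>R \<tau>) x < 2 * r"
      using dist_triangle[of "z + s *\<^sub>R \<tau>" x z] that(1) t(2) by linarith
    have tan: "(s *\<^sub>R \<tau>) \<bullet> \<nu> j = 0" if "j \<in> active x" for j
      using single[OF that] \<tau> by simp
    have **: "dist (z + s *\<^sub>R \<tau>) x < r2" using * r(3) by linarith
    show "z \<in> \<Omega> \<Longrightarrow> z + s *\<^sub>R \<tau> \<in> \<Omega>" "z \<in> K \<Longrightarrow> z + s *\<^sub>R \<tau> \<in> K"
      using tangential_segment[OF x tan r2(2) **] by blast+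
  qed
  have "(G x - G (x + t *\<^sub>R \<tau>)) \<bullet> n \<le> - (t * (c / 2))"
  proof (rule le_on_K_if_le_on_\<Omega>[OF x open_ball])
    show "x \<in> ball x r" using r(1) by simp
    show "continuous_on (K \<inter> ball x r) (\<lambda>z. (G z - G (z + t *\<^sub>R \<tau>)) \<bullet> n)"
      by (intro continuous_intros continuous_on_subset[OF cont_G] continuous_on_compose2[OF cont_G])
         (use seg(3) t(1) in \<open>auto simp: dist_commute\<close>)
    fix z assume z: "z \<in> \<Omega> \<inter> ball x r"
    then have zr: "dist z x < r" by (simp add: dist_commute)
    have "((\<lambda>s. G (z + s *\<^sub>R \<tau>) \<bullet> n) has_real_derivative H (z + s *\<^sub>R \<tau>) \<tau> \<bullet> n) (at s)"
      if "0 \<le> s" "s \<le> t" for s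
    proof -
      have line: "((\<lambda>s. z + s *\<^sub>R \<tau>) has_derivative (\<lambda>h. h *\<^sub>R \<tau>)) (at s)"
        by (auto intro!: derivative_eq_intros)
      have "((\<lambda>s. G (z + s *\<^sub>R \<tau>) \<bullet> n) has_derivative (\<lambda>h. H (z + s *\<^sub>R \<tau>) (h *\<^sub>R \<tau>) \<bullet> n)) (at s)"
        using z seg(2)[OF zr that]
        by (intro has_derivative_inner_left has_derivative_compose[OF line deriv_G]) auto
      then show ?thesis
        by (simp add: has_field_derivative_def linear_scale[OF linear_H] mult.commute[of _ "_ \<bullet> _"])
    qed
    from MVT2[OF t(1) this] obtain s where s: "0 < s" "s < t"
      "G (z + t *\<^sub>R \<tau>) \<bullet> n - G (z + 0 *\<^sub>R \<tau>) \<bullet> n = (t - 0) * (H (z + s *\<^sub>R \<tau>) \<tau> \<bullet> n)"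
      by blast
    have "z + s *\<^sub>R \<tau> \<in> K" "dist (z + s *\<^sub>R \<tau>) x < r1"
      using seg[OF zr, of s] s z \<Omega>_subset_K r by auto
    then have "c / 2 \<le> H (z + s *\<^sub>R \<tau>) \<tau> \<bullet> n"
      using r1(2)[of "z + s *\<^sub>R \<tau>"] unfolding dist_real_def by linarith
    then have "t * (c / 2) \<le> t * (H (z + s *\<^sub>R \<tau>) \<tau> \<bullet> n)" using t(1) by simp
    then show "(G z - G (z + t *\<^sub>R \<tau>)) \<bullet> n \<le> - (t * (c / 2))"
      using s(3) by (simp add: inner_diff_left)
  qed
  moreover have "G x \<bullet> n = - \<gamma> i" "G (x + t *\<^sub>R \<tau>) \<bullet> n = - \<gamma> i"
    unfolding n_def using i seg(3)[of x t] x r(1) t(1) \<tau>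
    by (auto simp: active_def inner_add_left intro!: neumann)
  moreover have "t * (c / 2) > 0" using t(1) \<open>c > 0\<close> by simp
  ultimately show False by (simp add: inner_diff_left)
qed

text \<open>Let \<open>y\<close> be the tangential part of \<open>H x (\<nu> i)\<close>. Symmetry
  turns \<open>y \<bullet> y\<close> into \<open>H x y \<bullet> \<nu> i\<close>, so the one-sided
  bound already forces \<open>y = 0\<close>.\<close>

lemma H_normal_eigenvector:
  assumes x: "x \<in> K" and i: "i \<in> active x" and single: "\<And>j. j \<in> active x \<Longrightarrow> \<nu> j = \<nu> i"
  shows "H x (\<nu> i) = (H x (\<nu> i) \<bullet> \<nu> i) *\<^sub>R \<nu> i"
proof -
  define y where "y = H x (\<nu> i) - (H x (\<nu> i) \<bullet> \<nu> i) *\<^sub>R \<nu> i"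
  have "\<nu> i \<bullet> \<nu> i = 1" using i norm_normal by (simp add: active_def norm_eq_1)
  then have y: "y \<bullet> \<nu> i = 0" by (simp add: y_def inner_diff_left)
  have "H x y \<bullet> \<nu> i \<le> 0" by (rule H_tangential_normal_le[OF assms y])
  moreover have "y \<bullet> y = H x y \<bullet> \<nu> i"
    using y symmetric_H[OF x, of "\<nu> i" y]
    by (subst (1) y_def) (simp add: inner_diff_left inner_commute[of "\<nu> i" y])
  ultimately have "y = 0" by (metis inner_gt_zero_iff not_le)
  then show ?thesis by (simp add: y_def)
qed

text \<open>On a face, the trace identity trades the second normal derivative for tangential ones.\<close>

lemma no_touching_single_normal:
  assumes x1: "x1 \<in> K" and single: "\<And>i j. i \<in> active x1 \<Longrightarrow> j \<in> active x1 \<Longrightarrow> \<nu> i = \<nu> j"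
    and \<phi>: "has_grad_laplacian \<phi> g L U" "x1 \<in> U" "L x1 < 0"
    and g: "\<And>i. i \<in> active x1 \<Longrightarrow> g x1 \<bullet> \<nu> i > 0"
    and "d > 0"
    and max: "\<And>x. x \<in> K \<Longrightarrow> dist x x1 < d \<Longrightarrow> hessian_sq x - \<phi> x \<le> hessian_sq x1 - \<phi> x1"
  shows False
proof -
  obtain p q :: "'a \<Rightarrow> 'a" and c where
    tan: "\<And>k i. k \<in> Basis \<Longrightarrow> i \<in> active x1 \<Longrightarrow> p k \<bullet> \<nu> i = 0"
         "\<And>k i. k \<in> Basis \<Longrightarrow> i \<in> active x1 \<Longrightarrow> q k \<bullet> \<nu> i = 0"
    and c: "\<And>x. x \<in> K \<Longrightarrow> (\<Sum>k\<in>Basis. H x (p k) \<bullet> q k) = (\<Sum>k\<in>Basis. H x k \<bullet> H x1 k) + c"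
  proof (cases "active x1 = {}")
    case True
    then show ?thesis using that[of "\<lambda>k. k" "H x1" 0] by simp
  next
    case False
    then obtain i where i: "i \<in> active x1" by blast
    define n where "n = \<nu> i"
    have n: "\<nu> j = n" if "j \<in> active x1" for j using single[OF that i] by (simp add: n_def)
    have nn: "n \<bullet> n = 1" using i norm_normal by (simp add: active_def norm_eq_1 n_def)
    define \<beta> where "\<beta> = H x1 n \<bullet> n"
    have eig: "H x1 n = \<beta> *\<^sub>R n"
      using H_normal_eigenvector[OF x1 i] n by (simp add: n_def \<beta>_def)
    \<comment> \<open>The deflated pairing with \<open>H x1\<close>. The first family is projected
      off \<open>n\<close>; the second is orthogonal to \<open>n\<close> because \<open>n\<close> is
      an eigenvector of the symmetric map \<open>H x1\<close>. The trace \<open>- \<mu>\<close>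
      contributes the constant \<open>\<beta> * \<mu>\<close>.\<close>
    show ?thesis
    proof (rule that[of "\<lambda>k. k - (k \<bullet> n) *\<^sub>R n" "\<lambda>k. H x1 k - \<beta> *\<^sub>R k" "\<beta> * \<mu>"])
      show "(k - (k \<bullet> n) *\<^sub>R n) \<bullet> \<nu> j = 0" if "j \<in> active x1" for k j
        using n[OF that] nn by (simp add: inner_diff_left)
      show "(H x1 k - \<beta> *\<^sub>R k) \<bullet> \<nu> j = 0" if "j \<in> active x1" for k j
        using n[OF that] symmetric_H[OF x1, of k n] eig
        by (simp add: inner_diff_left inner_commute[of n k])
      show "(\<Sum>k\<in>Basis. H x (k - (k \<bullet> n) *\<^sub>R n) \<bullet> (H x1 k - \<beta> *\<^sub>R k)) =
          (\<Sum>k\<in>Basis. H x k \<bullet> H x1 k) + \<beta> * \<mu>" if "x \<in> K" for x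
        using inner_maps_deflate[where B = "H x1", OF linear_H linear_H eig, of x] trace_H[OF that] by simp
    qed
  qed
  \<comment> \<open>The support inequality involves twice the linear functional, hence half of
    \<phi>.\<close>
  have "has_grad_laplacian (\<lambda>x. (1/2) * \<phi> x) (\<lambda>x. (1/2) *\<^sub>R g x) (\<lambda>x. (1/2) * L x) U"
    by (rule has_grad_laplacian_cmul[OF \<phi>(1)])
  from x1 finite_Basis tan single this \<phi>(2) show False
  proof (rule no_touching_linear[OF _ _ _ _ _ _ _ _ _ \<open>d > 0\<close>])
    show "1/2 * L x1 < 0" using \<phi>(3) by simp
    show "((1/2) *\<^sub>R g x1) \<bullet> \<nu> i > 0" if "i \<in> active x1" for i using g[OF that] by simp
    fix x assume x: "x \<in> K" "dist x x1 < d"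
    show "(\<Sum>k\<in>Basis. H x (p k) \<bullet> q k) - 1/2 * \<phi> x \<le> (\<Sum>k\<in>Basis. H x1 (p k) \<bullet> q k) - 1/2 * \<phi> x1"
      using max[OF x] hessian_sq_ge[of x x1] unfolding c[OF x(1)] c[OF x1]
      by (simp add: hessian_sq_def)
  qed
qed

text \<open>At points of higher codimension, a small multiple of the logarithmic barrier moves the maximum
  to a point with fewer active faces.\<close>

lemma no_touching:
  assumes "x0 \<in> K" "has_grad_laplacian \<phi> g L U" "x0 \<in> U" "L x0 < 0"
    and "\<And>i. i \<in> active x0 \<Longrightarrow> g x0 \<bullet> \<nu> i > 0" and "d > 0"
    and "\<And>x. x \<in> K \<Longrightarrow> dist x x0 < d \<Longrightarrow> hessian_sq x - \<phi> x \<le> hessian_sq x0 - \<phi> x0"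
  shows False
  using assms
proof (induction "card (active x0)" arbitrary: x0 \<phi> g L U d rule: less_induct)
  case less
  note x0 = less.prems(1) and \<phi> = less.prems(2-4) and g = less.prems(5) and max = less.prems(7)
  show False
  proof (cases "\<forall>i\<in>active x0. \<forall>j\<in>active x0. \<nu> i = \<nu> j")
    case True
    then show False
      using no_touching_single_normal[OF x0 _ \<phi> g less.prems(6) max] by blast
  next
    case False
    then obtain i j where ij: "i \<in> active x0" "j \<in> active x0" "\<nu> i \<noteq> \<nu> j" by blast
    obtain y where y: "y \<in> \<Omega>" using nonempty by blast
    \<comment> \<open>Faces with opposite normals through one point would leave no interior. So two
      normals at \<open>x0\<close> are linearly independent and the barrier has codimension at least
      two.\<close>
    have "\<nu> i \<noteq> - \<nu> j"
    proof
      assume eq: "\<nu> i = - \<nu> j"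
      have "y \<bullet> \<nu> i < b i" "y \<bullet> \<nu> j < b j" "x0 \<bullet> \<nu> i = b i" "x0 \<bullet> \<nu> j = b j"
        using y ij by (auto simp: \<Omega>_eq active_def)
      then show False by (simp add: eq)
    qed
    then have "2 \<le> dim (span (\<nu> ` active x0))"
      using ij norm_normal
      by (intro dim_ge_2_if_not_parallel[of "\<nu> i" "\<nu> j"]) (auto simp: active_def intro!: span_base)
    moreover obtain B where B: "pairwise orthogonal B" "\<And>x. x \<in> B \<Longrightarrow> norm x = 1"
      "independent B" "card B = dim (span (\<nu> ` active x0))" "span B = span (\<nu> ` active x0)"
      using orthonormal_basis_subspace[OF subspace_span, of "\<nu> ` active x0"] by metis
    ultimately have card_B: "2 \<le> card B" by simp
    have fin_B: "finite B" using B(3) by (rule independent_imp_finite)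
    have normal_in: "\<nu> k \<in> span B" if "k \<in> active x0" for k
      using that B(5) by (auto intro: span_base)
    \<comment> \<open>The squared distance to the affine subspace where all faces active at
      \<open>x0\<close> are met simultaneously.\<close>
    define q where "q x = (\<Sum>e\<in>B. ((x - x0) \<bullet> e)\<^sup>2)" for x
    have cont_q: "continuous_on S q" for S
      unfolding q_def by (intro continuous_intros)
    have q_nonneg: "q x \<ge> 0" for x unfolding q_def by (intro sum_nonneg) auto
    have q_zero: "(x - x0) \<bullet> n = 0" if "q x = 0" "n \<in> span B" for x n
    proof -
      have "\<forall>e\<in>B. ((x - x0) \<bullet> e)\<^sup>2 = 0"
        using that(1) fin_B unfolding q_def by (subst (asm) sum_nonneg_eq_0_iff) auto
      then show ?thesis
        using orthogonal_to_span[OF that(2), of "x - x0"] by (simp add: orthogonal_def)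
    qed
    have q_zero': "q x = 0" if "\<And>k. k \<in> active x0 \<Longrightarrow> x \<bullet> \<nu> k = b k" for x
    proof -
      have "orthogonal (x - x0) n" if "n \<in> span (\<nu> ` active x0)" for n
        by (rule orthogonal_to_span[OF that])
           (use \<open>\<And>k. k \<in> active x0 \<Longrightarrow> x \<bullet> \<nu> k = b k\<close> in
             \<open>auto simp: orthogonal_def inner_diff_left active_def\<close>)
      then show ?thesis
        using span_base[of _ B]
        by (auto simp: q_def orthogonal_def B(5)[symmetric] intro!: sum.neutral)
    qed
    obtain gh Lh where h: "has_grad_laplacian (\<lambda>x. - ln (q x)) gh Lh {x. q x > 0}"
      and Lh: "\<And>x. q x > 0 \<Longrightarrow> Lh x \<le> 0"
      and gh: "\<And>x n. n \<in> span B \<Longrightarrow> (x - x0) \<bullet> n = 0 \<Longrightarrow> gh x \<bullet> n = 0"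
      using log_barrier[OF fin_B B(1,2) card_B, of x0] unfolding q_def by metis
    obtain \<eta> r1 g' L' where \<eta>: "\<eta> > 0" and r1: "r1 > 0"
      and \<phi>'0: "has_grad_laplacian (\<lambda>x. \<phi> x + \<eta> * (norm (x - x0))\<^sup>2) g' L' U"
      and test: "\<forall>x. dist x x0 < r1 \<longrightarrow> x \<in> U \<and> L' x < 0 \<and> (\<forall>i\<in>active x0. g' x \<bullet> \<nu> i > 0)"
      using strict_test_function[OF \<phi> g] by blast
    define \<phi>' where "\<phi>' x = \<phi> x + \<eta> * (norm (x - x0))\<^sup>2" for x
    have \<phi>': "has_grad_laplacian \<phi>' g' L' U" unfolding \<phi>'_def by (rule \<phi>'0)
    obtain r2 where r2: "r2 > 0" "\<And>z i. dist z x0 < r2 \<Longrightarrow> i \<in> I \<Longrightarrow> i \<notin> active x0 \<Longrightarrow> z \<bullet> \<nu> i < b i"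
      using inactive_nearby[of x0] x0 by metis
    \<comment> \<open>Where \<open>q < 1\<close>, the barrier \<open>- ln q\<close> is positive off
      its zero set, so subtracting it only lowers \<open>u\<close>.\<close>
    have "q x0 < 1" by (simp add: q_def)
    then have "eventually (\<lambda>x. q x < 1) (nhds x0)"
      using eventually_nhds_in_open[of "{x. q x < 1}" x0]
      by (simp add: open_Collect_less cont_q)
    then obtain r3 where r3: "r3 > 0" "\<And>x. dist x x0 < r3 \<Longrightarrow> q x < 1"
      by (auto simp: eventually_nhds_metric)
    obtain R where R: "R > 0" "R < r1" "R < r2" "R < r3" "R < d"
    proof -
      have "0 < Min {r1, r2, r3, d}" using r1 r2 r3 less.prems(6) by simp
      then obtain R where "0 < R" "R < Min {r1, r2, r3, d}" using dense by blast
      then show ?thesis by (intro that[of R]) auto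
    qed
    define u where "u x = hessian_sq x - \<phi>' x" for x
    define D where "D = K \<inter> cball x0 R"
    have D: "x \<in> K" "dist x x0 \<le> R" "x \<in> U" "q x < 1" if "x \<in> D" for x
      using that R test r3(2)[of x] by (auto simp: D_def dist_commute)
    have "compact D" unfolding D_def using compact_K by (simp add: compact_Int)
    have cont_u: "continuous_on D u"
      unfolding u_def[abs_def]
      by (intro continuous_on_diff continuous_on_subset[OF cont_hessian_sq]
            continuous_on_subset[OF has_grad_laplacianD(3)[OF \<phi>']]) (use D in auto)
    have u_le: "u x \<le> u x0 - \<eta> * (dist x x0)\<^sup>2" if "x \<in> D" for x
      using max[of x] D[OF that] R unfolding u_def \<phi>'_def dist_norm by simp
    \<comment> \<open>On the sphere of radius \<open>R\<close>, \<open>u\<close> lies below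
      \<open>u x0\<close> by at least \<delta>; all later losses are budgeted against this
      drop.\<close>
    define \<delta> where "\<delta> = \<eta> * R\<^sup>2"
    have "\<delta> > 0" using \<eta> R(1) by (simp add: \<delta>_def)
    have u_max: "u x \<le> u x0" if "x \<in> D" for x
    proof -
      have "0 \<le> \<eta> * (dist x x0)\<^sup>2" using \<eta> by simp
      then show ?thesis using u_le[OF that] by linarith
    qed
    \<comment> \<open>At \<open>x0\<close> the barrier is infinite, so an interior point with nearly
      the same value of \<open>u\<close> takes its place as competitor.\<close>
    obtain z where z: "z \<in> \<Omega> \<inter> ball x0 R" "u z > u x0 - \<delta> / 3"
    proof -
      have ev: "eventually (\<lambda>s. x0 + s *\<^sub>R (y - x0) \<in> \<Omega> \<inter> ball x0 R) (at_right 0)"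
        by (rule eventually_toward_interior[OF x0 y open_ball]) (use R in simp)
      have "((\<lambda>s. u (x0 + s *\<^sub>R (y - x0))) \<longlongrightarrow> u x0) (at_right 0)"
      proof (rule continuous_on_tendsto_compose[OF cont_u tendsto_toward_interior])
        show "x0 \<in> D" using x0 R(1) by (simp add: D_def)
        show "eventually (\<lambda>s. x0 + s *\<^sub>R (y - x0) \<in> D) (at_right 0)"
          using ev by (rule eventually_mono) (use \<Omega>_subset_K in \<open>auto simp: D_def\<close>)
      qed
      then have "eventually (\<lambda>s. u (x0 + s *\<^sub>R (y - x0)) > u x0 - \<delta> / 3) (at_right 0)"
        by (rule order_tendstoD) (use \<open>\<delta> > 0\<close> in simp)
      with ev have "eventually (\<lambda>s. x0 + s *\<^sub>R (y - x0) \<in> \<Omega> \<inter> ball x0 R \<and>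
          u (x0 + s *\<^sub>R (y - x0)) > u x0 - \<delta> / 3) (at_right 0)"
        by (rule eventually_conj)
      then obtain s where "x0 + s *\<^sub>R (y - x0) \<in> \<Omega> \<inter> ball x0 R \<and>
          u (x0 + s *\<^sub>R (y - x0)) > u x0 - \<delta> / 3"
        using eventually_happens'[OF trivial_limit_at_right_real] by blast
      then show ?thesis using that by blast
    qed
    have zD: "z \<in> D" using z(1) \<Omega>_subset_K by (auto simp: D_def)
    have "q z \<noteq> 0"
    proof
      assume "q z = 0"
      then have "z \<bullet> \<nu> i = x0 \<bullet> \<nu> i"
        using q_zero[OF _ normal_in[OF ij(1)], of z] by (simp add: inner_diff_left)
      then show False using z(1) ij(1) by (auto simp: \<Omega>_eq active_def)
    qed
    then have qz: "q z > 0" "q z < 1" using q_nonneg[of z] D(4)[OF zD] by auto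
    \<comment> \<open>The penalty at \<open>z\<close> is exactly \<delta> / 3, so the penalized
      value there exceeds \<open>u x0 - \<delta>\<close>.\<close>
    define \<epsilon> where "\<epsilon> = \<delta> / 3 / (- ln (q z))"
    have "- ln (q z) > 0" using qz by simp
    then have \<epsilon>: "\<epsilon> > 0" "\<epsilon> * (- ln (q z)) = \<delta> / 3"
      unfolding \<epsilon>_def using \<open>\<delta> > 0\<close> by (intro divide_pos_pos, auto)
    \<comment> \<open>Below this level of \<open>q\<close> the penalty alone exceeds \<delta>. The
      maximum may therefore be sought on the compact set \<open>q \<ge> \<kappa>\<close> and still
      dominates all nearby points with \<open>q > 0\<close>.\<close>
    define \<kappa> where "\<kappa> = exp (- (\<delta> / \<epsilon>))"
    have "\<kappa> > 0" by (simp add: \<kappa>_def)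
    have small_q: "\<epsilon> * (- ln (q x)) > \<delta>" if "0 < q x" "q x < \<kappa>" for x
    proof -
      have "ln (q x) < ln \<kappa>" using that \<open>\<kappa> > 0\<close> by simp
      also have "ln \<kappa> = - (\<delta> / \<epsilon>)" by (simp add: \<kappa>_def)
      finally have "\<delta> / \<epsilon> < - ln (q x)" by simp
      then show ?thesis using \<epsilon>(1) by (simp add: field_simps)
    qed
    have "\<kappa> \<le> q z"
    proof (rule ccontr)
      assume "\<not> \<kappa> \<le> q z"
      then have "\<epsilon> * (- ln (q z)) > \<delta>" using qz by (intro small_q) auto
      then show False using \<epsilon>(2) \<open>\<delta> > 0\<close> by simp
    qed
    define E where "E = D \<inter> {x. \<kappa> \<le> q x}"
    have "compact E" unfolding E_def
      by (intro compact_Int_closed \<open>compact D\<close> closed_Collect_le cont_q continuous_on_const)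
    moreover have "continuous_on E (\<lambda>x. u x - \<epsilon> * (- ln (q x)))"
      by (intro continuous_intros continuous_on_subset[OF cont_u] cont_q)
         (use \<open>\<kappa> > 0\<close> in \<open>auto simp: E_def\<close>)
    moreover have zE: "z \<in> E" using zD \<open>\<kappa> \<le> q z\<close> by (simp add: E_def)
    ultimately obtain x1 where x1: "x1 \<in> E"
      "\<And>x. x \<in> E \<Longrightarrow> u x - \<epsilon> * (- ln (q x)) \<le> u x1 - \<epsilon> * (- ln (q x1))"
      using continuous_attains_sup[of E "\<lambda>x. u x - \<epsilon> * (- ln (q x))"] by blast
    have val: "u x1 - \<epsilon> * (- ln (q x1)) > u x0 - \<delta>"
      using x1(2)[OF zE] z(2) \<epsilon>(2) \<open>\<delta> > 0\<close> by linarith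
    have x1D: "x1 \<in> D" and qx1: "q x1 > 0" using x1(1) \<open>\<kappa> > 0\<close> by (auto simp: E_def)
    have "\<epsilon> * (- ln (q x1)) \<ge> 0" using \<epsilon>(1) qx1 D(4)[OF x1D] by (intro mult_nonneg_nonneg) auto
    then have "\<eta> * (dist x1 x0)\<^sup>2 < \<delta>" using val u_le[OF x1D] by linarith
    then have "(dist x1 x0)\<^sup>2 < R\<^sup>2" using \<eta> by (simp add: \<delta>_def)
    then have x1R: "dist x1 x0 < R" using R(1) by (simp add: power2_less_imp_less)
    have active_sub: "active x1 \<subseteq> active x0"
    proof
      fix k assume "k \<in> active x1"
      then show "k \<in> active x0" using r2(2)[of x1 k] x1R R(3) by (force simp: active_def)
    qed
    \<comment> \<open>If no face were lost, \<open>x1\<close> would lie on the singular subspace,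
      where \<open>q\<close> vanishes.\<close>
    moreover have "active x1 \<noteq> active x0"
      using q_zero'[of x1] qx1 by (auto simp: active_def)
    ultimately have card_less: "card (active x1) < card (active x0)"
      using finite_I by (intro psubset_card_mono) (auto simp: active_def)
    define V where "V = U \<inter> {x. q x > 0}"
    have "open V" unfolding V_def
      using has_grad_laplacianD(1)[OF \<phi>'] has_grad_laplacianD(1)[OF h] by (rule open_Int)
    then have \<phi>'': "has_grad_laplacian (\<lambda>x. \<phi>' x + \<epsilon> * (- ln (q x))) (\<lambda>x. g' x + \<epsilon> *\<^sub>R gh x)
        (\<lambda>x. L' x + \<epsilon> * Lh x) V"
      by (intro has_grad_laplacian_add has_grad_laplacian_cmul has_grad_laplacian_subset[OF \<phi>']
            has_grad_laplacian_subset[OF h]) (auto simp: V_def)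
    have "x1 \<in> V" using D(3)[OF x1D] qx1 by (simp add: V_def)
    \<comment> \<open>The ball must avoid \<open>q = 0\<close>: there the barrier has the junk value \<open>- ln 0 = 0\<close>.\<close>
    obtain e where e: "e > 0" "ball x1 e \<subseteq> {x. q x > 0}"
      using has_grad_laplacianD(1)[OF h] qx1 unfolding open_contains_ball by blast
    show False
    proof (rule less.hyps[OF card_less D(1)[OF x1D] \<phi>'' \<open>x1 \<in> V\<close>])
      have "\<epsilon> * Lh x1 \<le> 0" using \<epsilon>(1) Lh[OF qx1] by (simp add: mult_nonneg_nonpos)
      moreover have "L' x1 < 0" using test x1R R(2) by auto
      ultimately show "L' x1 + \<epsilon> * Lh x1 < 0" by linarith
      show "(g' x1 + \<epsilon> *\<^sub>R gh x1) \<bullet> \<nu> k > 0" if k: "k \<in> active x1" for k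
      proof -
        have k0: "k \<in> active x0" using k active_sub by blast
        have "(x1 - x0) \<bullet> \<nu> k = 0" using k k0 by (simp add: active_def inner_diff_left)
        then have "gh x1 \<bullet> \<nu> k = 0" using gh normal_in[OF k0] by blast
        moreover have "g' x1 \<bullet> \<nu> k > 0" using test x1R R(2) k0 by auto
        ultimately show ?thesis by (simp add: inner_add_left)
      qed
      show "min e (R - dist x1 x0) > 0" using e(1) x1R by simp
      fix x assume x: "x \<in> K" "dist x x1 < min e (R - dist x1 x0)"
      have xD: "x \<in> D"
        using x dist_triangle[of x x0 x1] by (simp add: D_def dist_commute)
      have qx: "q x > 0" using x(2) e(2) by (auto simp: dist_commute subset_iff)
      have "u x - \<epsilon> * (- ln (q x)) \<le> u x1 - \<epsilon> * (- ln (q x1))"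
      proof (cases "\<kappa> \<le> q x")
        case True
        then show ?thesis using xD by (intro x1(2)) (simp add: E_def)
      next
        case False
        then have "\<epsilon> * (- ln (q x)) > \<delta>" using qx by (intro small_q) auto
        then show ?thesis using val u_max[OF xD] by linarith
      qed
      then show "hessian_sq x - (\<phi>' x + \<epsilon> * (- ln (q x))) \<le> hessian_sq x1 - (\<phi>' x1 + \<epsilon> * (- ln (q x1)))"
        by (simp add: u_def)
    qed
  qed
qed

section \<open>Constancy of the Hessian and integration\<close>

lemma hessian_sq_constant:
  obtains N where "\<And>x. x \<in> K \<Longrightarrow> hessian_sq x \<le> N" "\<And>x. x \<in> \<Omega> \<Longrightarrow> hessian_sq x = N"
proof -
  have "K \<noteq> {}" using nonempty \<Omega>_subset_K by blast
  then obtain z where z: "z \<in> K" "\<And>x. x \<in> K \<Longrightarrow> hessian_sq x \<le> hessian_sq z"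
    using continuous_attains_sup[OF compact_K _ cont_hessian_sq] by blast
  have "hessian_sq y = hessian_sq z" if y: "y \<in> \<Omega>" for y
  proof (rule ccontr)
    have yK: "y \<in> K" using y \<Omega>_subset_K by blast
    assume "hessian_sq y \<noteq> hessian_sq z"
    then have less: "hessian_sq y < hessian_sq z" using z(2)[OF yK] by simp
    obtain x \<phi> g L c d where x: "x \<in> K" and \<phi>: "has_grad_laplacian \<phi> g L UNIV" "L x < 0"
      and c: "c > 0" "g x = c *\<^sub>R (x - y)" and d: "d > 0"
      and max: "\<And>w. w \<in> K \<Longrightarrow> dist w x < d \<Longrightarrow> hessian_sq w - \<phi> w \<le> hessian_sq x - \<phi> x"
      using hopf_barrier[OF compact_K cont_hessian_sq z(2) z(1) refl yK less] by metis
    \<comment> \<open>On an active face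
      \<open>(x - y) \<bullet> \<nu> i = b i - y \<bullet> \<nu> i\<close>, positive for interior
      \<open>y\<close>.\<close>
    have "g x \<bullet> \<nu> i > 0" if "i \<in> active x" for i
      using that y c by (auto simp: active_def \<Omega>_eq inner_diff_left)
    then show False using no_touching[OF x \<phi>(1) UNIV_I \<phi>(2) _ d max] by blast
  qed
  then show ?thesis using that z(2) by blast
qed

text \<open>With \<open>hessian_sq\<close> equal to \<open>N\<close>, the functional
  \<open>w\<close> is at most \<open>N\<close>, with equality at \<open>x\<close>. If
  \<open>w = N\<close> near \<open>x\<close>, the squared distance of \<open>H y\<close> and
  \<open>H x\<close> is N + N - 2 N = 0. The Hopf barrier is used in a ball inside \<Omega>, where
  no face is active.\<close>

lemma H_locally_constant:
  assumes x: "x \<in> \<Omega>"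
  obtains r where "r > 0" "\<And>y. dist y x < r \<Longrightarrow> H y = H x"
proof -
  obtain N where N: "\<And>x. x \<in> K \<Longrightarrow> hessian_sq x \<le> N" "\<And>x. x \<in> \<Omega> \<Longrightarrow> hessian_sq x = N"
    using hessian_sq_constant by blast
  obtain R where R: "R > 0" "cball x R \<subseteq> \<Omega>"
    using open_\<Omega> x open_contains_cball by blast
  define w where "w z = (\<Sum>i\<in>Basis. H z i \<bullet> H x i)" for z
  have w_le: "w z \<le> N" if "z \<in> cball x R" for z
    using hessian_sq_ge[of z x] N(2) x that R(2) unfolding w_def by fastforce
  have w_x: "w x = N" using N(2)[OF x] by (simp add: w_def hessian_sq_def)
  have cont_w: "continuous_on (cball x R) w"
    unfolding w_def[abs_def] using R(2) \<Omega>_subset_K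
    by (intro continuous_on_sum continuous_on_subset[OF cont_H_inner]) blast
  have "H y = H x" if y: "dist y x < R / 2" for y
  proof -
    have y_in: "y \<in> cball x R" using y R(1) by (simp add: dist_commute)
    have "w y = N"
    proof (rule ccontr)
      assume "w y \<noteq> N"
      then have less: "w y < N" using w_le[OF y_in] by simp
      have x_in: "x \<in> cball x R" using R(1) by simp
      obtain x1 \<phi> g L c d where x1: "x1 \<in> cball x R" "dist x1 y \<le> dist x y"
        and \<phi>: "has_grad_laplacian \<phi> g L UNIV" "L x1 < 0" and d: "d > 0"
        and max: "\<And>z. z \<in> cball x R \<Longrightarrow> dist z x1 < d \<Longrightarrow> w z - \<phi> z \<le> w x1 - \<phi> x1"
        using hopf_barrier[OF compact_cball cont_w w_le x_in w_x y_in less] by metis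
      \<comment> \<open>The barrier's contact point is no farther from \<open>y\<close> than
        \<open>x\<close> is, hence within R/2 of \<open>y\<close>; so it avoids the boundary of the
        ball.\<close>
      have x1R: "dist x1 x < R"
        using dist_triangle[of x1 x y] x1(2) y by (simp add: dist_commute)
      have x1\<Omega>: "x1 \<in> \<Omega>" using x1(1) R(2) by blast
      have x1K: "x1 \<in> K" using x1\<Omega> \<Omega>_subset_K by blast
      have act: "active x1 = {}" using active_empty_iff[OF x1K] x1\<Omega> by simp
      show False
      proof (rule no_touching_linear[of x1 Basis "\<lambda>k. k" "H x" \<phi> g L UNIV "min d (R - dist x1 x)"])
        show "min d (R - dist x1 x) > 0" using d x1R by simp
        fix z assume "z \<in> K" and z: "dist z x1 < min d (R - dist x1 x)"
        have "z \<in> cball x R" using z dist_triangle[of z x x1] by (simp add: dist_commute)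
        then show "(\<Sum>k\<in>Basis. H z k \<bullet> H x k) - \<phi> z \<le> (\<Sum>k\<in>Basis. H x1 k \<bullet> H x k) - \<phi> x1"
          using max[of z] z unfolding w_def by simp
      qed (use x1K \<phi> act in auto)
    qed
    then have "(\<Sum>i\<in>Basis. (H y i - H x i) \<bullet> (H y i - H x i)) = 0"
      using hessian_sq_diff[of y x] N(2)[OF x] N(2)[of y] y_in R(2) unfolding w_def by auto
    then have "\<forall>i\<in>Basis. (H y i - H x i) \<bullet> (H y i - H x i) = 0"
      by (subst (asm) sum_nonneg_eq_0_iff) auto
    then show "H y = H x"
      by (intro linear_eq_stdbasis linear_H) auto
  qed
  with R(1) show ?thesis by (intro that[of "R / 2"] half_gt_zero)
qed

text \<open>Local constancy becomes global because \<Omega> is connected, and integrating twice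
  gives the quadratic. Symmetry of \<open>H x0\<close> ensures that half its quadratic form has
  gradient \<open>H x0 x\<close>; continuity covers the boundary.\<close>

lemma v_quadratic:
  obtains A a c where "linear A" "\<And>x. x \<in> K \<Longrightarrow> v x = A x \<bullet> x + a \<bullet> x + c"
proof -
  obtain x0 where x0: "x0 \<in> \<Omega>" using nonempty by blast
  have "\<Omega> = (\<Inter>i\<in>I. {x. \<nu> i \<bullet> x < b i})" by (auto simp: \<Omega>_eq inner_commute)
  then have conv: "convex \<Omega>" by (auto intro!: convex_INT convex_halfspace_lt)
  have H: "H x = H x0" if "x \<in> \<Omega>" for x
  proof (rule connected_local_const[OF convex_connected[OF conv] that x0])
    show "\<forall>a\<in>\<Omega>. eventually (\<lambda>b. H a = H b) (at a within \<Omega>)"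
    proof
      fix a assume "a \<in> \<Omega>"
      then obtain r where "r > 0" "\<And>y. dist y a < r \<Longrightarrow> H y = H a"
        using H_locally_constant by blast
      then show "eventually (\<lambda>b. H a = H b) (at a within \<Omega>)"
        unfolding eventually_at by metis
    qed
  qed
  have bl: "bounded_linear (H x0)" using linear_H by (simp add: linear_conv_bounded_linear)
  have dH: "(H x0 has_derivative H x0) (at x)" for x
    by (rule bounded_linear_imp_has_derivative[OF bl])
  have "((\<lambda>x. G x - H x0 x) has_derivative (\<lambda>e. 0)) (at x within \<Omega>)" if "x \<in> \<Omega>" for x
    using has_derivative_diff[OF deriv_G[OF that] dH] H[OF that] by (simp add: has_derivative_at_withinI)
  from has_derivative_zero_constant[OF conv this]
  obtain a where a: "\<And>x. x \<in> \<Omega> \<Longrightarrow> G x - H x0 x = a" by blast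
  have "((\<lambda>x. v x - ((1/2) *\<^sub>R H x0 x \<bullet> x + a \<bullet> x)) has_derivative (\<lambda>e. 0)) (at x within \<Omega>)"
    if x: "x \<in> \<Omega>" for x
  proof -
    have "((\<lambda>x. v x - ((1/2) *\<^sub>R H x0 x \<bullet> x + a \<bullet> x)) has_derivative
        (\<lambda>e. e \<bullet> G x - ((1/2) *\<^sub>R H x0 x \<bullet> e + (1/2) *\<^sub>R H x0 e \<bullet> x + a \<bullet> e))) (at x)"
      by (rule has_derivative_diff[OF deriv_v[OF x] has_derivative_add[OF
            has_derivative_inner[OF has_derivative_scaleR_right[OF dH] has_derivative_ident]
            has_derivative_inner_right[OF has_derivative_ident]]])
    moreover have "e \<bullet> G x - ((1/2) *\<^sub>R H x0 x \<bullet> e + (1/2) *\<^sub>R H x0 e \<bullet> x + a \<bullet> e) = 0" for e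
      using symmetric_H_interior[OF x0, of e x]
      by (simp add: a[OF x, symmetric] inner_diff_left inner_commute[of e])
    ultimately show ?thesis by (simp add: has_derivative_at_withinI)
  qed
  from has_derivative_zero_constant[OF conv this]
  obtain c where c: "\<And>x. x \<in> \<Omega> \<Longrightarrow> v x - ((1/2) *\<^sub>R H x0 x \<bullet> x + a \<bullet> x) = c" by blast
  show ?thesis
  proof (rule that[of "\<lambda>x. (1/2) *\<^sub>R H x0 x" a c])
    show "linear (\<lambda>x. (1/2) *\<^sub>R H x0 x)" by (intro linear_compose_scale_right linear_H)
    fix x assume x: "x \<in> K"
    have "v x - ((1/2) *\<^sub>R H x0 x \<bullet> x + a \<bullet> x) = c"
      by (rule eq_on_K_if_eq_on_\<Omega>[OF x _ c])
         (intro continuous_intros cont_v linear_continuous_on[OF bl])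
    then show "v x = (1/2) *\<^sub>R H x0 x \<bullet> x + a \<bullet> x + c" by simp
  qed
qed

end

section \<open>Transfer to coordinates\<close>

lemma sum_Basis_vec:
  fixes f :: "real^'d \<Rightarrow> 'b::comm_monoid_add"
  shows "(\<Sum>e\<in>Basis. f e) = (\<Sum>i\<in>UNIV. f (axis i 1))"
proof -
  have Basis: "Basis = range (\<lambda>i. axis i (1::real) :: real^'d)" by (auto simp: Basis_vec_def)
  have "inj (\<lambda>i. axis i (1::real) :: real^'d)" by (auto simp: inj_def axis_eq_axis)
  then show ?thesis unfolding Basis by (rule sum.reindex[unfolded o_def])
qed

lemma linear_axis_expansion:
  fixes f :: "real^'d \<Rightarrow> 'b::real_vector"
  assumes "linear f"
  shows "f e = (\<Sum>i\<in>UNIV. (e $ i) *\<^sub>R f (axis i 1))"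
proof -
  have "f e = f (\<Sum>i\<in>UNIV. (e $ i) *\<^sub>R axis i 1)"
    using basis_expansion[of e] by (simp add: scalar_mult_eq_scaleR)
  then show ?thesis by (simp add: linear_sum[OF assms] linear_scale[OF assms])
qed

lemma differentiable_imp_dir_deriv:
  assumes "f differentiable (at x)"
  shows "(f has_derivative (\<lambda>e. dir_deriv e f x)) (at x)"
    and "dir_deriv e f x = (\<Sum>i\<in>UNIV. e $ i * partial_deriv i f x)"
proof -
  show *: "(f has_derivative (\<lambda>e. dir_deriv e f x)) (at x)"
    using assms by (simp add: dir_deriv_def[abs_def] frechet_derivative_works[symmetric])
  show "dir_deriv e f x = (\<Sum>i\<in>UNIV. e $ i * partial_deriv i f x)"
    using linear_axis_expansion[OF has_derivative_linear[OF *], of e] by simp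
qed

text \<open>For open convex sets with a common point, closure commutes with the intersection; each
  single half-space has a nonzero normal.\<close>

lemma closure_halfspaces_Int:
  assumes "finite I" "\<And>i. i \<in> I \<Longrightarrow> \<nu> i \<noteq> 0" "halfspaces_Int \<nu> b I \<noteq> {}"
  shows "closure (halfspaces_Int \<nu> b I) = {x. \<forall>i\<in>I. x \<bullet> \<nu> i \<le> b i}"
proof -
  let ?F = "(\<lambda>i. {x. \<nu> i \<bullet> x < b i}) ` I"
  have eq: "halfspaces_Int \<nu> b I = \<Inter>?F" by (auto simp: halfspaces_Int_def inner_commute)
  have "closure (\<Inter>?F) = \<Inter>(closure ` ?F)"
    by (subst closure_Inter_convex_open)
       (use assms(3) in \<open>auto simp: eq convex_halfspace_lt open_halfspace_lt\<close>)
  also have "\<dots> = {x. \<forall>i\<in>I. x \<bullet> \<nu> i \<le> b i}"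
    using assms(2) by (auto simp: closure_halfspace_lt inner_commute[of _ "\<nu> _"])
  finally show ?thesis unfolding eq .
qed

theorem theorem4p5:
  fixes \<Omega> :: "(real^'d) set"
    and m :: nat
    and \<nu> :: "nat \<Rightarrow> real^'d"
    and b :: "nat \<Rightarrow> real"
    and \<mu> :: real
    and \<gamma> :: "nat \<Rightarrow> real"
    and v :: "real^'d \<Rightarrow> real"
  assumes "convex_polyhedral_domain \<Omega> m \<nu> b"
    and "neumann_solution \<Omega> m \<nu> b \<mu> \<gamma> v"
    and "C2_closure \<Omega> v"
  shows "\<exists>(a :: 'd \<Rightarrow> 'd \<Rightarrow> real) (\<beta> :: 'd \<Rightarrow> real) (c :: real). \<forall>x\<in>closure \<Omega>.
           v x = (\<Sum>i\<in>UNIV. \<Sum>j\<in>UNIV. a i j * x $ i * x $ j) + (\<Sum>i\<in>UNIV. \<beta> i * x $ i) + c"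
proof -
  have \<Omega>: "\<Omega> \<noteq> {}" "bounded \<Omega>" "\<Omega> = halfspaces_Int \<nu> b {1..m}"
    and norm: "\<And>i. i \<in> {1..m} \<Longrightarrow> norm (\<nu> i) = 1"
    using assms(1) by (auto simp: convex_polyhedral_domain_def)
  have \<Omega>_eq: "\<Omega> = {x. \<forall>i\<in>{1..m}. x \<bullet> \<nu> i < b i}"
    by (subst \<Omega>(3)) (auto simp: halfspaces_Int_def)
  have "\<nu> i \<noteq> 0" if "i \<in> {1..m}" for i using norm[OF that] by auto
  then have K_eq: "closure \<Omega> = {x. \<forall>i\<in>{1..m}. x \<bullet> \<nu> i \<le> b i}"
    using closure_halfspaces_Int[of "{1..m}" \<nu> b] \<Omega>(1,3) by simp
  have C2: "continuous_on (closure \<Omega>) v" "\<And>x. x \<in> \<Omega> \<Longrightarrow> v differentiable (at x)"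
    "\<And>i x. x \<in> \<Omega> \<Longrightarrow> partial_deriv i v differentiable (at x)"
    using assms(3) by (auto simp: C2_closure_def)
  have "\<forall>i. \<exists>g. continuous_on (closure \<Omega>) g \<and> (\<forall>x\<in>\<Omega>. g x = partial_deriv i v x)"
    using assms(3) by (simp add: C2_closure_def extends_continuously_def)
  then obtain g where g: "\<And>i. continuous_on (closure \<Omega>) (g i)"
    "\<And>i x. x \<in> \<Omega> \<Longrightarrow> g i x = partial_deriv i v x" by metis
  have "\<forall>i j. \<exists>h. continuous_on (closure \<Omega>) h \<and>
      (\<forall>x\<in>\<Omega>. h x = partial_deriv j (partial_deriv i v) x)"
    using assms(3) by (simp add: C2_closure_def extends_continuously_def)
  then obtain h where h: "\<And>i j. continuous_on (closure \<Omega>) (h i j)"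
    "\<And>i j x. x \<in> \<Omega> \<Longrightarrow> h i j x = partial_deriv j (partial_deriv i v) x" by metis
  \<comment> \<open>Built from the continuous extensions, since \<open>partial_deriv\<close> is
    meaningful for \<open>v\<close> only inside \<Omega>.\<close>
  define G :: "real^'d \<Rightarrow> real^'d" where "G x = (\<chi> i. g i x)" for x
  define H :: "real^'d \<Rightarrow> real^'d \<Rightarrow> real^'d" where "H x e = (\<chi> i. \<Sum>j\<in>UNIV. e $ j * h i j x)" for x e
  have "open (\<Inter>i\<in>{1..m}. {x. \<nu> i \<bullet> x < b i})"
    by (intro open_INT) (auto simp: open_halfspace_lt)
  then have open_\<Omega>: "open \<Omega>"
    unfolding \<Omega>(3) halfspaces_Int_def by (simp add: inner_commute)
  have G_dir: "e \<bullet> G x = dir_deriv e v x" if "x \<in> \<Omega>" for x e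
    using differentiable_imp_dir_deriv(2)[OF C2(2)[OF that], of e] g(2)[OF that]
    by (simp add: inner_vec_def G_def)
  have cont_G: "continuous_on (closure \<Omega>) G"
    unfolding G_def[abs_def] by (intro continuous_on_vec_lambda g(1))
  interpret neumann_C2 "{1..m}" \<nu> b \<mu> \<gamma> v G H \<Omega> "closure \<Omega>"
  proof (rule neumann_C2.intro)
    show "finite {1..m}" by simp
    show "norm (\<nu> i) = 1" if "i \<in> {1..m}" for i by (rule norm[OF that])
    show "\<Omega> = {x. \<forall>i\<in>{1..m}. x \<bullet> \<nu> i < b i}" by (rule \<Omega>_eq)
    show "closure \<Omega> = {x. \<forall>i\<in>{1..m}. x \<bullet> \<nu> i \<le> b i}" by (rule K_eq)
    show "\<Omega> \<noteq> {}" by (rule \<Omega>(1))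
    show "bounded (closure \<Omega>)" using \<Omega>(2) by (rule bounded_closure)
    show "continuous_on (closure \<Omega>) v" by (rule C2(1))
    show "continuous_on (closure \<Omega>) G" by (rule cont_G)
    show "continuous_on (closure \<Omega>) (\<lambda>x. H x e)" for e
      unfolding H_def by (intro continuous_on_vec_lambda continuous_intros h(1))
    show "linear (H x)" for x
      by (rule linearI)
         (auto simp: H_def vec_eq_iff sum.distrib sum_distrib_left distrib_right mult.assoc)
    show "(v has_derivative (\<lambda>e. e \<bullet> G x)) (at x)" if x: "x \<in> \<Omega>" for x
      using differentiable_imp_dir_deriv(1)[OF C2(2)[OF x]] by (simp add: G_dir[OF x])
    show "(G has_derivative H x) (at x)" if x: "x \<in> \<Omega>" for x
    proof (subst has_derivative_componentwise_within, intro ballI)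
      fix k :: "real^'d" assume "k \<in> Basis"
      then obtain i where k: "k = axis i 1" by (auto simp: Basis_vec_def)
      have "H x e \<bullet> k = dir_deriv e (partial_deriv i v) x" for e
        unfolding differentiable_imp_dir_deriv(2)[OF C2(3)[OF x, of i], of e]
        by (simp add: H_def k inner_axis h(2)[OF x])
      then have "(partial_deriv i v has_derivative (\<lambda>e. H x e \<bullet> k)) (at x)"
        using differentiable_imp_dir_deriv(1)[OF C2(3)[OF x, of i]] by simp
      then show "((\<lambda>x. G x \<bullet> k) has_derivative (\<lambda>e. H x e \<bullet> k)) (at x)"
        by (rule has_derivative_transform_within_open[OF _ open_\<Omega> x])
           (simp add: G_def k inner_axis g(2))
    qed
    show "(\<Sum>i\<in>Basis. H x i \<bullet> i) = - \<mu>" if x: "x \<in> \<Omega>" for x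
    proof -
      have "(\<Sum>j\<in>UNIV. axis i 1 $ j * h i j x) = h i i x" for i
        by (simp add: axis_def if_distrib[of "\<lambda>t. t * _"] cong: if_cong)
      then have "(\<Sum>i\<in>Basis. H x i \<bullet> i) = (\<Sum>i\<in>UNIV. h i i x)"
        by (simp add: sum_Basis_vec H_def inner_axis)
      also have "\<dots> = laplacian v x" by (simp add: laplacian_def h(2)[OF x])
      also have "\<dots> = - \<mu>" using assms(2) x by (simp add: neumann_solution_def eq_neg_iff_add_eq_0)
      finally show ?thesis .
    qed
    show "G x \<bullet> \<nu> i = - \<gamma> i" if "x \<in> closure \<Omega>" "i \<in> {1..m}" "x \<bullet> \<nu> i = b i" for x i
    proof -
      \<comment> \<open>\<open>G \<bullet> \<nu> i\<close> is a continuous extension of the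
        directional derivative, so it computes the limit in the boundary condition.\<close>
      have "cont_extension \<Omega> (dir_deriv (\<nu> i) v) x = G x \<bullet> \<nu> i"
        by (rule cont_extension_eq[OF open_\<Omega>, where g = "\<lambda>x. G x \<bullet> \<nu> i"])
           (use that(1) G_dir in \<open>auto intro!: continuous_intros cont_G simp: inner_commute[of "G _"]\<close>)
      moreover have "cont_extension \<Omega> (dir_deriv (\<nu> i) v) x + \<gamma> i = 0"
        using assms(2) that by (simp add: neumann_solution_def face_def)
      ultimately show ?thesis by simp
    qed
  qed
  obtain A a c where A: "linear A" and v: "\<And>x. x \<in> closure \<Omega> \<Longrightarrow> v x = A x \<bullet> x + a \<bullet> x + c"
    using v_quadratic by metis
  have "A x \<bullet> x = (\<Sum>i\<in>UNIV. \<Sum>j\<in>UNIV. A (axis j 1) $ i * x $ i * x $ j)" for x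
    by (subst linear_axis_expansion[OF A])
       (simp add: inner_sum_left inner_vec_def sum_distrib_left mult_ac)
  then show ?thesis
    by (intro exI[of _ "\<lambda>i j. A (axis j 1) $ i"] exI[of _ "\<lambda>i. a $ i"] exI[of _ c])
       (simp add: v inner_vec_def)
qed

end
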